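(* Let $q(x_1,x_2,\dots,x_n)$ be a $P$-hyperbolic homogeneous polynomial of degree $n$ in $n$ real variables. Let $e_i$ be the $i$-th canonical basis vector of $\mathbb{R}^n$, let $R_i=\mathrm{Rank}_q(e_i)$, and define $G_i=\min(R_i,\,n+1-i)$ for $1\le i\le n$. 1. Then $$\frac{\partial^n}{\partial x_1\cdots\partial x_n} q(0,\dots,0)\ \ge\ \prod_{1\le i\le n}\left(\frac{G_i-1}{G_i}\right)^{G_i-1}\mathrm{Cap}(q).$$ 2. If $k$ is an integer with $1\le k\le n$ and $\mathrm{Rank}_q(e_i)\le k$ for all $1\le i\le n$, then $$\frac{\partial^n}{\partial x_1\cdots\partial x_n} q(0,\dots,0)\ \ge\ \left(\frac{k-1}{k}\right)^{(k-1)(n-k)}\frac{k!}{k^k}\,\mathrm{Cap}(q).$$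
   Context: A homogeneous real polynomial $p(x)$, $x\in\mathbb{R}^m$, of degree $n$ is called hyperbolic in the direction $e\in\mathbb{R}^m$ (or $e$-hyperbolic) if $p(e)>0$ and for every $x\in\mathbb{R}^m$ the polynomial $\lambda\mapsto p(x-\lambda e)$ has exactly $n$ real roots, counted with multiplicity, denoted $\lambda_1(x)\ge\dots\ge\lambda_n(x)$. A vector $x$ is $e$-nonnegative if $\lambda_n(x)\ge 0$. The $p$-rank of $x$ is $\mathrm{Rank}_p(x)=|\{i:\lambda_i(x)\ne 0\}|$. A homogeneous polynomial $p$ of degree $n$ in $n$ real variables is called $P$-hyperbolic if it is hyperbolic in the direction $e=(1,1,\dots,1)$ (in particular $p(e)>0$) and every vector of the nonnegative orthant $\mathbb{R}^n_+=\{x: x_i\ge 0,\ 1\le i\le n\}$ is $e$-nonnegative. For a $P$-hyperbolic polynomial the rank is taken with respect to $e=(1,\dots,1)$. The capacity of a homogeneous polynomial $q$ of degree $n$ in $n$ variables is $$\mathrm{Cap}(q)=\inf\Big\{q(x_1,\dots,x_n): x_i>0,\ \prod_{i=1}^n x_i=1\Big\}.$$ Conventions: $0^0=1$ (so a factor with $G_i=1$, or $k=1$, equals $1$), and a factor with $G_i=0$ is read as $1$. *)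

theory Defs
  imports "HOL-Analysis.Analysis" "HOL-Computational_Algebra.Computational_Algebra"
begin

text \<open>
  A vector of \<open>\<real>\<^sup>m\<close> is represented by any function \<open>x :: nat \<Rightarrow> real\<close>; its coordinates are
  \<open>x 1, \<dots>, x m\<close> and the other values play no role. Real polynomials in \<open>m\<close> variables are
  represented by their polynomial functions.
\<close>

definition multi_indices :: "nat \<Rightarrow> nat \<Rightarrow> (nat \<Rightarrow> nat) set" where
  "multi_indices m d = {a \<in> {1..m} \<rightarrow>\<^sub>E UNIV. (\<Sum>i=1..m. a i) = d}"

text \<open>As usual, the zero polynomial counts as homogeneous of every degree.\<close>

definition homogeneous_poly :: "nat \<Rightarrow> nat \<Rightarrow> ((nat \<Rightarrow> real) \<Rightarrow> real) \<Rightarrow> bool" where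
  "homogeneous_poly m d p \<longleftrightarrow>
     (\<exists>c. \<forall>x. p x = (\<Sum>a\<in>multi_indices m d. c a * (\<Prod>i=1..m. x i ^ a i)))"

lemma finite_multi_indices: "finite (multi_indices m d)"
proof (rule finite_subset)
  show "multi_indices m d \<subseteq> {1..m} \<rightarrow>\<^sub>E {..d}"
  proof
    fix a assume a: "a \<in> multi_indices m d"
    have "a i \<le> d" if "i \<in> {1..m}" for i
      using a member_le_sum[of i "{1..m}" a] that by (auto simp: multi_indices_def)
    with a show "a \<in> {1..m} \<rightarrow>\<^sub>E {..d}"
      by (auto simp: multi_indices_def PiE_iff)
  qed
qed (simp add: finite_PiE)

text \<open>
  The univariate polynomial \<open>\<lambda> \<mapsto> p(x - \<lambda>e)\<close>. The description is proper for every polynomial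
  \<open>p\<close>; see \<open>poly_line_poly\<close> below.
\<close>

definition line_poly :: "((nat \<Rightarrow> real) \<Rightarrow> real) \<Rightarrow> (nat \<Rightarrow> real) \<Rightarrow> (nat \<Rightarrow> real) \<Rightarrow> real poly" where
  "line_poly p e x = (THE r. \<forall>t. poly r t = p (\<lambda>i. x i - t * e i))"

lemma poly_line_poly:
  assumes "homogeneous_poly m d p"
  shows "poly (line_poly p e x) t = p (\<lambda>i. x i - t * e i)"
proof -
  obtain c where c: "p x = (\<Sum>a\<in>multi_indices m d. c a * (\<Prod>i=1..m. x i ^ a i))" for x
    using assms unfolding homogeneous_poly_def by blast
  define r where
    "r = (\<Sum>a\<in>multi_indices m d. smult (c a) (\<Prod>i=1..m. [:x i, - e i:] ^ a i))"
  have r: "\<forall>t. poly r t = p (\<lambda>i. x i - t * e i)"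
    by (simp add: r_def c poly_sum poly_prod)
  have "\<forall>t. poly (line_poly p e x) t = p (\<lambda>i. x i - t * e i)"
    unfolding line_poly_def
  proof (rule theI[of _ r])
    fix s assume "\<forall>t. poly s t = p (\<lambda>i. x i - t * e i)"
    with r have "poly s = poly r" by auto
    then show "s = r" by (simp add: poly_eq_poly_eq_iff)
  qed (rule r)
  then show ?thesis by blast
qed

text \<open>
  \<open>p\<close> is homogeneous of degree \<open>n\<close> in \<open>m\<close> variables. Note that \<open>proots\<close> is the multiset of
  (real) roots and is empty for the zero polynomial.
\<close>

definition hyperbolic :: "nat \<Rightarrow> nat \<Rightarrow> ((nat \<Rightarrow> real) \<Rightarrow> real) \<Rightarrow> (nat \<Rightarrow> real) \<Rightarrow> bool" where
  "hyperbolic m n p e \<longleftrightarrow>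
     homogeneous_poly m n p \<and> p e > 0 \<and> (\<forall>x. size (proots (line_poly p e x)) = n)"

text \<open>
  \<open>eig p e x i\<close> is \<open>\<lambda>\<^sub>i(x)\<close>, for \<open>1 \<le> i \<le> n\<close>: the roots are listed in nonincreasing order with
  multiplicity, and numbered from 1.
\<close>

definition eig :: "((nat \<Rightarrow> real) \<Rightarrow> real) \<Rightarrow> (nat \<Rightarrow> real) \<Rightarrow> (nat \<Rightarrow> real) \<Rightarrow> nat \<Rightarrow> real" where
  "eig p e x i = rev (sorted_list_of_multiset (proots (line_poly p e x))) ! (i - 1)"

definition e_nonnegative ::
  "nat \<Rightarrow> ((nat \<Rightarrow> real) \<Rightarrow> real) \<Rightarrow> (nat \<Rightarrow> real) \<Rightarrow> (nat \<Rightarrow> real) \<Rightarrow> bool" where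
  "e_nonnegative n p e x \<longleftrightarrow> eig p e x n \<ge> 0"

definition hyp_rank ::
  "nat \<Rightarrow> ((nat \<Rightarrow> real) \<Rightarrow> real) \<Rightarrow> (nat \<Rightarrow> real) \<Rightarrow> (nat \<Rightarrow> real) \<Rightarrow> nat" where
  "hyp_rank n p e x = card {i \<in> {1..n}. eig p e x i \<noteq> 0}"

definition ones :: "nat \<Rightarrow> real" where
  "ones = (\<lambda>_. 1)"

definition basis_vec :: "nat \<Rightarrow> nat \<Rightarrow> real" where
  "basis_vec i = (\<lambda>j. if j = i then 1 else 0)"

definition P_hyperbolic :: "nat \<Rightarrow> ((nat \<Rightarrow> real) \<Rightarrow> real) \<Rightarrow> bool" where
  "P_hyperbolic n p \<longleftrightarrow>
     hyperbolic n n p ones \<and> (\<forall>x. (\<forall>i\<in>{1..n}. x i \<ge> 0) \<longrightarrow> e_nonnegative n p ones x)"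

text \<open>
  The infimum is meaningful in \<open>real\<close> for a P-hyperbolic polynomial, the only case used:
  \<open>p(x) = p(e) \<lambda>\<^sub>1(x) \<cdots> \<lambda>\<^sub>n(x) \<ge> 0\<close> on the nonnegative orthant, and \<open>p(e)\<close> is one of the values.
\<close>

definition Cap :: "nat \<Rightarrow> ((nat \<Rightarrow> real) \<Rightarrow> real) \<Rightarrow> real" where
  "Cap n p = Inf {p x |x. (\<forall>i\<in>{1..n}. x i > 0) \<and> (\<Prod>i=1..n. x i) = 1}"

definition partial_deriv ::
  "nat \<Rightarrow> ((nat \<Rightarrow> real) \<Rightarrow> real) \<Rightarrow> ((nat \<Rightarrow> real) \<Rightarrow> real)" where
  "partial_deriv i f = (\<lambda>x. deriv (\<lambda>t. f (x(i := t))) (x i))"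

text \<open>\<open>\<partial>\<^sup>n / (\<partial>x\<^sub>1 \<cdots> \<partial>x\<^sub>n)\<close>\<close>

definition mixed_deriv :: "nat \<Rightarrow> ((nat \<Rightarrow> real) \<Rightarrow> real) \<Rightarrow> ((nat \<Rightarrow> real) \<Rightarrow> real)" where
  "mixed_deriv n f = foldr partial_deriv [1..<Suc n] f"

definition G :: "nat \<Rightarrow> ((nat \<Rightarrow> real) \<Rightarrow> real) \<Rightarrow> nat \<Rightarrow> nat" where
  "G n q i = min (hyp_rank n q ones (basis_vec i)) (n + 1 - i)"

text \<open>
  \<open>((g - 1) / g)\<^bsup>g - 1\<^esup>\<close>. The exponent is a truncated difference of naturals, so the value is 1
  both for \<open>g = 1\<close> (that is, \<open>0\<^sup>0 = 1\<close>) and, by convention, for \<open>g = 0\<close>.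
\<close>

definition g_factor :: "nat \<Rightarrow> real" where
  "g_factor g = ((real g - 1) / real g) ^ (g - 1)"

end

theory Submission
  imports Defs
begin

text \<open>
  The numbers in the bound come from a one-variable fact. Let
  \<open>f t = c * (\<Prod>i. 1 + t * l i)\<close> have at most \<open>k\<close> factors, all with \<open>l i \<ge> 0\<close>, and let
  \<open>f t \<ge> C * t\<close> for every \<open>t > 0\<close>. The inequality of arithmetic and geometric means gives
  \<open>C * t \<le> c * (1 + t * S / k) ^ k\<close>, where \<open>c * S\<close> is the slope of \<open>f\<close> at 0, and the best choice of
  \<open>t\<close> turns this into \<open>c * S \<ge> ((k - 1) / k) ^ (k - 1) * C\<close>
  (\<open>linear_bound_imp_slope_bound\<close>).

  The mixed derivative is computed one variable at a time. Suppose that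
  \<open>p y \<ge> C * y\<^sub>i * \<dots> * y\<^sub>n\<close> at all positive vectors \<open>y\<close>; for the given polynomial this holds with
  \<open>i = 1\<close> and \<open>C\<close> its capacity. The one-variable fact, applied to \<open>t \<mapsto> p (y + t e\<^sub>i)\<close>, yields the
  same kind of bound for \<open>\<partial>\<^sub>i p\<close>, with \<open>y\<^sub>i\<close> removed from the product and \<open>C\<close> multiplied by one
  factor of the theorem (\<open>capacity_dir_deriv\<close>). All polynomials stay functions of the original
  \<open>n\<close> variables: the eliminated ones are not set to 0, so that only the behaviour inside the positive
  orthant matters. After \<open>n\<close> steps the polynomial is a constant, the mixed derivative
  (\<open>capacity_elimination\<close>).

  Two things make the step work. Firstly, \<open>t \<mapsto> p (y + t e\<^sub>i)\<close> must have only negative real roots,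
  and this must be inherited by \<open>\<partial>\<^sub>i p\<close>. The property that is carried along is that
  \<open>\<bar>p (x + \<i> y)\<bar> \<ge> p y > 0\<close> for all real \<open>x\<close> and all positive \<open>y\<close> (\<open>stable_form\<close>). It is hyperbolicity
  in all positive directions at once, and as a non-strict inequality for the modulus it survives
  limits. A derivative in a positive direction has it by an argument of Gauss-Lucas type, and
  the derivative along a coordinate axis, as a limit of those, has it or is zero
  (\<open>stable_form_dir_deriv_boundary\<close>). The polynomial at the start has it by Garding's theorem, proved
  here by a homotopy during which no root crosses the real axis (\<open>garding\<close>).
  Secondly, the degree of \<open>t \<mapsto> p (y + t e\<^sub>i)\<close> must be bounded by the rank of \<open>e\<^sub>i\<close>. This is expressed as
  the vanishing of the iterated derivative of order \<open>R + 1\<close> in the variable \<open>x\<^sub>i\<close>, where \<open>R\<close> is that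
  rank, a condition that the other derivatives preserve. This derivative vanishes at the vector of
  ones by the definition of the rank, and a stable form does not vanish there, so it must be the
  zero polynomial (\<open>funpow_dir_deriv_rank\<close>).

  The second part follows from the first, because \<open>((g - 1) / g) ^ (g - 1)\<close> does not increase with \<open>g\<close>,
  and its product over \<open>g = 1, \<dots>, k\<close> telescopes to \<open>k! / k\<^sup>k\<close>.
\<close>

section \<open>Homogeneous real polynomials on complex vectors\<close>

definition cvec :: "(nat \<Rightarrow> real) \<Rightarrow> nat \<Rightarrow> complex" where
  "cvec x = (\<lambda>i. of_real (x i))"

text \<open>
  An inductive presentation instead of coefficients: closure under multiplication by a variable
  and under sums is exactly what derivatives and restrictions to lines need, so that everything
  in this section is proved by induction without handling multi-indices. The constants are real, although the
  arguments are complex vectors.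
\<close>

inductive real_form :: "nat \<Rightarrow> nat \<Rightarrow> ((nat \<Rightarrow> complex) \<Rightarrow> complex) \<Rightarrow> bool" for n where
  zero: "real_form n d (\<lambda>z. 0)"
| const: "real_form n 0 (\<lambda>z. of_real c)"
| var: "i \<in> {1..n} \<Longrightarrow> real_form n d p \<Longrightarrow> real_form n (Suc d) (\<lambda>z. z i * p z)"
| add: "real_form n d p \<Longrightarrow> real_form n d q \<Longrightarrow> real_form n d (\<lambda>z. p z + q z)"

lemma real_form_scale:
  assumes "real_form n d p"
  shows "real_form n d (\<lambda>z. of_real c * p z)"
  using assms
proof induction
  case (const a)
  show ?case using real_form.const[of n "c * a"] by simp
next
  case (var i d p)
  then show ?case using real_form.var[OF var.hyps(1) var.IH] by (simp add: algebra_simps)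
next
  case (add d p q)
  then show ?case using real_form.add[OF add.IH] by (simp add: algebra_simps)
qed (use real_form.zero in auto)

lemma real_form_sum:
  assumes "finite A" "\<And>a. a \<in> A \<Longrightarrow> real_form n d (f a)"
  shows "real_form n d (\<lambda>z. \<Sum>a\<in>A. f a z)"
  using assms by (induction A) (auto intro: real_form.intros)

lemma real_form_var_power:
  assumes "i \<in> {1..n}" "real_form n d p"
  shows "real_form n (k + d) (\<lambda>z. z i ^ k * p z)"
proof (induction k)
  case (Suc k)
  then show ?case using real_form.var[OF assms(1) Suc] by (simp add: mult_ac)
qed (use assms in simp)

lemma real_form_monomial:
  assumes "finite I" "I \<subseteq> {1..n}"
  shows "real_form n (\<Sum>i\<in>I. a i) (\<lambda>z. \<Prod>i\<in>I. z i ^ a i)"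
  using assms
proof (induction I)
  case empty
  show ?case using real_form.const[of n 1] by simp
next
  case (insert i I)
  then show ?case using real_form_var_power[of i n "sum a I" _ "a i"] by simp
qed

lemma real_form_homogeneous:
  assumes "real_form n d p"
  shows "p (\<lambda>i. c * z i) = c ^ d * p z"
  using assms by (induction arbitrary: z) (auto simp: algebra_simps)

lemma real_form_cnj:
  assumes "real_form n d p"
  shows "p (\<lambda>i. cnj (z i)) = cnj (p z)"
  using assms by (induction arbitrary: z) auto

lemma real_form_real:
  assumes "real_form n d p"
  shows "p (cvec x) = of_real (Re (p (cvec x)))"
  using real_form_cnj[OF assms, of "cvec x"]
  by (metis (no_types, lifting) Reals_cnj_iff complex_cnj_complex_of_real cvec_def of_real_Re ext)

lemma real_form_cong:
  assumes "real_form n d p" "\<And>i. i \<in> {1..n} \<Longrightarrow> z i = w i"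
  shows "p z = p w"
  using assms by (induction) auto

lemma real_form_continuous:
  assumes "real_form n d p" "\<And>i. i \<in> {1..n} \<Longrightarrow> continuous_on S (\<lambda>u. Z u i)"
  shows "continuous_on S (\<lambda>u. p (Z u))"
  using assms by induction (auto intro!: continuous_intros)

text \<open>
  On a line the form is a univariate polynomial whose coefficient in degree \<open>d\<close> is the value in the
  direction of the line. Positivity on the orthant thus fixes the degree for positive directions.
\<close>

lemma real_form_line:
  assumes "real_form n d p"
  shows "\<exists>f. degree f \<le> d \<and> coeff f d = p w \<and> (\<forall>s. poly f s = p (\<lambda>i. z i + s * w i))"
  using assms
proof induction
  case (zero d)
  show ?case by (rule exI[of _ 0]) auto
next
  case (const c)
  show ?case by (rule exI[of _ "[:of_real c:]"]) auto
next
  case (var i d p)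
  then obtain f where f: "degree f \<le> d" "coeff f d = p w" "\<And>s. poly f s = p (\<lambda>i. z i + s * w i)"
    by blast
  have "degree ([:z i, w i:] * f) \<le> Suc d"
    using degree_mult_le[of "[:z i, w i:]" f] f(1) by (auto intro: order_trans split: if_splits)
  moreover have "coeff f (Suc d) = 0"
    using f(1) by (simp add: coeff_eq_0)
  ultimately show ?case
    using f by (intro exI[of _ "[:z i, w i:] * f"]) (auto simp: algebra_simps)
next
  case (add d p q)
  then obtain f g where f: "degree f \<le> d" "coeff f d = p w" "\<And>s. poly f s = p (\<lambda>i. z i + s * w i)"
    and g: "degree g \<le> d" "coeff g d = q w" "\<And>s. poly g s = q (\<lambda>i. z i + s * w i)"
    by blast
  show ?case
    using f g by (intro exI[of _ "f + g"]) (auto simp: degree_add_le)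
qed

definition dir_deriv ::
  "(nat \<Rightarrow> real) \<Rightarrow> ((nat \<Rightarrow> complex) \<Rightarrow> complex) \<Rightarrow> (nat \<Rightarrow> complex) \<Rightarrow> complex" where
  "dir_deriv v p z = deriv (\<lambda>s. p (\<lambda>i. z i + s * of_real (v i))) 0"

lemma real_form_has_deriv:
  assumes "real_form n d p"
  shows "((\<lambda>s. p (\<lambda>i. z i + s * of_real (v i))) has_field_derivative
           dir_deriv v p (\<lambda>i. z i + t * of_real (v i))) (at t)"
proof -
  obtain f where f: "\<And>s. poly f s = p (\<lambda>i. z i + s * of_real (v i))"
    using real_form_line[OF assms, of "\<lambda>i. of_real (v i)" z] by blast
  have eq: "(\<lambda>s. p (\<lambda>i. z i + s * of_real (v i))) = poly f"
    using f by auto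
  have "(\<lambda>s. p (\<lambda>i. z i + t * of_real (v i) + s * of_real (v i))) = (\<lambda>s. poly f (t + s))"
    by (simp add: f algebra_simps)
  moreover have "((\<lambda>s. poly f (t + s)) has_field_derivative poly (pderiv f) t) (at 0)"
    by (rule derivative_eq_intros refl poly_DERIV DERIV_chain' | simp)+
  ultimately have "dir_deriv v p (\<lambda>i. z i + t * of_real (v i)) = poly (pderiv f) t"
    unfolding dir_deriv_def by (simp add: DERIV_imp_deriv)
  then show ?thesis
    unfolding eq by simp
qed

lemma dir_deriv_zero: "dir_deriv v (\<lambda>z. 0) = (\<lambda>z. 0)"
  by (simp add: dir_deriv_def fun_eq_iff)

lemma dir_deriv_const: "dir_deriv v (\<lambda>z. c) = (\<lambda>z. 0)"
  by (simp add: dir_deriv_def fun_eq_iff)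

lemma dir_deriv_at:
  assumes "real_form n d p"
  shows "((\<lambda>s. p (\<lambda>i. z i + s * of_real (v i))) has_field_derivative dir_deriv v p z) (at 0)"
  using real_form_has_deriv[OF assms, of z v 0] by simp

lemma dir_deriv_add:
  assumes "real_form n d p" "real_form n e q"
  shows "dir_deriv v (\<lambda>z. p z + q z) = (\<lambda>z. dir_deriv v p z + dir_deriv v q z)"
proof
  fix z
  show "dir_deriv v (\<lambda>z. p z + q z) z = dir_deriv v p z + dir_deriv v q z"
    unfolding dir_deriv_def[of v "\<lambda>z. p z + q z"]
    by (intro DERIV_imp_deriv DERIV_add dir_deriv_at[OF assms(1)] dir_deriv_at[OF assms(2)])
qed

lemma dir_deriv_cmult:
  assumes "real_form n d p"
  shows "dir_deriv v (\<lambda>z. c * p z) = (\<lambda>z. c * dir_deriv v p z)"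
proof
  fix z
  show "dir_deriv v (\<lambda>z. c * p z) z = c * dir_deriv v p z"
    unfolding dir_deriv_def[of v "\<lambda>z. c * p z"]
    by (intro DERIV_imp_deriv DERIV_cmult dir_deriv_at[OF assms(1)])
qed

lemma dir_deriv_var:
  assumes "real_form n d p"
  shows "dir_deriv v (\<lambda>z. z i * p z) = (\<lambda>z. of_real (v i) * p z + z i * dir_deriv v p z)"
proof
  fix z
  have "((\<lambda>s. (z i + s * of_real (v i)) * p (\<lambda>i. z i + s * of_real (v i))) has_field_derivative
          of_real (v i) * p z + z i * dir_deriv v p z) (at 0)"
    by (rule derivative_eq_intros dir_deriv_at[OF assms] refl | simp)+
  then show "dir_deriv v (\<lambda>z. z i * p z) z = of_real (v i) * p z + z i * dir_deriv v p z"
    unfolding dir_deriv_def[of v "\<lambda>z. z i * p z"] by (rule DERIV_imp_deriv)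
qed

lemma real_form_0_const:
  assumes "real_form n 0 p"
  shows "\<exists>c. p = (\<lambda>z. of_real c)"
  using assms
proof (induction "0::nat" p)
  case zero
  show ?case by (rule exI[of _ 0]) simp
next
  case (add p q)
  then show ?case by (metis of_real_add)
qed auto

text \<open>
  For \<open>d = 0\<close> the truncated difference is correct, because the derivative is then the zero form,
  which has every degree.
\<close>

lemma real_form_dir_deriv:
  assumes "real_form n d p"
  shows "real_form n (d - 1) (dir_deriv v p)"
  using assms
proof induction
  case (var i d p)
  show ?case
  proof (cases d)
    case 0
    with var.hyps obtain c where "p = (\<lambda>z. of_real c)" using real_form_0_const by blast
    then show ?thesis
      using real_form_scale[OF real_form.const[of n c], of "v i"]
      unfolding dir_deriv_var[OF var.hyps(2)] by (simp add: dir_deriv_const 0)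
  next
    case (Suc e)
    then have "real_form n d (\<lambda>z. z i * dir_deriv v p z)"
      using real_form.var[OF var.hyps(1) var.IH] by simp
    then show ?thesis
      unfolding dir_deriv_var[OF var.hyps(2)]
      using real_form.add[OF real_form_scale[OF var.hyps(2), of "v i"]] by simp
  qed
next
  case (add d p q)
  then show ?case by (simp add: dir_deriv_add[OF add.hyps] real_form.add)
qed (auto simp: dir_deriv_zero dir_deriv_const intro: real_form.zero)

lemma dir_deriv_commute:
  assumes "real_form n d p"
  shows "dir_deriv v (dir_deriv w p) = dir_deriv w (dir_deriv v p)"
  using assms
proof induction
  case (var i d p)
  have "dir_deriv a (dir_deriv b (\<lambda>z. z i * p z)) =
      (\<lambda>z. of_real (b i) * dir_deriv a p z
         + (of_real (a i) * dir_deriv b p z + z i * dir_deriv a (dir_deriv b p) z))" for a b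
  proof -
    note p' = real_form_dir_deriv[OF var.hyps(2), of b]
    show ?thesis
      unfolding dir_deriv_var[OF var.hyps(2)]
        dir_deriv_add[OF real_form_scale[OF var.hyps(2)] real_form.var[OF var.hyps(1) p']]
        dir_deriv_cmult[OF var.hyps(2)] dir_deriv_var[OF p'] ..
  qed
  then show ?case
    by (simp add: var.IH fun_eq_iff)
next
  case (add d p q)
  have "dir_deriv a (dir_deriv b (\<lambda>z. p z + q z)) =
      (\<lambda>z. dir_deriv a (dir_deriv b p) z + dir_deriv a (dir_deriv b q) z)" for a b
    unfolding dir_deriv_add[OF add.hyps]
      dir_deriv_add[OF real_form_dir_deriv[OF add.hyps(1)] real_form_dir_deriv[OF add.hyps(2)]] ..
  then show ?case
    by (simp add: add.IH)
qed (simp_all add: dir_deriv_zero dir_deriv_const)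

lemma dir_deriv_linear:
  assumes "real_form n d p"
  shows "dir_deriv (\<lambda>i. v i + a * w i) p z = dir_deriv v p z + of_real a * dir_deriv w p z"
  using assms
proof induction
  case (var i d p)
  show ?case
    unfolding dir_deriv_var[OF var.hyps(2)] by (simp add: var.IH algebra_simps)
next
  case (add d p q)
  show ?case
    unfolding dir_deriv_add[OF add.hyps] by (simp add: add.IH algebra_simps)
qed (simp_all add: dir_deriv_zero dir_deriv_const)

section \<open>Univariate polynomials with restricted roots\<close>

text \<open>
  Each factor \<open>t - r\<close> has modulus at least \<open>Im t\<close> when \<open>r\<close> lies in the closed lower half-plane. The
  coefficient in degree \<open>d\<close> takes the place of the leading one; if it vanishes, the bound is trivial,
  so that the exact degree never has to be determined.
\<close>

lemma norm_poly_ge_Im_power: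
  fixes f :: "complex poly"
  assumes "degree f \<le> d" "\<And>r. poly f r = 0 \<Longrightarrow> Im r \<le> 0" "0 \<le> Im t"
  shows "cmod (coeff f d) * Im t ^ d \<le> cmod (poly f t)"
proof (cases "coeff f d = 0")
  case False
  then have d: "degree f = d"
    using assms(1) le_degree[of f d] by auto
  obtain r where r: "smult (lead_coeff f) (\<Prod>i<d. [:- r i, 1:]) = f"
    using complex_poly_decompose'[of f] d by auto
  have f: "poly f u = coeff f d * (\<Prod>i<d. u - r i)" for u
    by (subst r[symmetric]) (simp add: poly_prod d)
  have "Im t \<le> cmod (t - r i)" if "i < d" for i
  proof -
    have "Im (r i) \<le> 0"
      by (rule assms(2)) (use that in \<open>auto simp: f\<close>)
    then have "Im t \<le> Im (t - r i)" by simp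
    also have "\<dots> \<le> cmod (t - r i)" using abs_Im_le_cmod abs_le_D1 by blast
    finally show ?thesis .
  qed
  then have "(\<Prod>i<d. Im t) \<le> (\<Prod>i<d. cmod (t - r i))"
    using assms(3) by (intro prod_mono) auto
  then show ?thesis
    by (simp add: f norm_mult prod_norm mult_left_mono)
qed simp

lemma has_field_derivative_prod_affine:
  fixes a b :: "nat \<Rightarrow> complex"
  assumes "\<And>i. i < m \<Longrightarrow> a i \<noteq> 0"
  shows "((\<lambda>s. \<Prod>i<m. a i + s * b i) has_field_derivative
           (\<Prod>i<m. a i) * (\<Sum>i<m. b i / a i)) (at 0)"
  using assms
proof (induction m)
  case (Suc m)
  have "((\<lambda>s. (\<Prod>i<m. a i + s * b i) * (a m + s * b m)) has_field_derivative
          (\<Prod>i<m. a i) * (\<Sum>i<m. b i / a i) * a m + b m * (\<Prod>i<m. a i)) (at 0)"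
    by (rule derivative_eq_intros Suc.IH refl | use Suc.prems in simp)+
  moreover have "(\<Prod>i<m. a i) * (\<Sum>i<m. b i / a i) * a m + b m * (\<Prod>i<m. a i)
      = (\<Prod>i<Suc m. a i) * (\<Sum>i<Suc m. b i / a i)"
    using Suc.prems[of m] by (simp add: field_simps)
  ultimately show ?case
    by simp
qed simp

text \<open>
  The special case of the Gauss-Lucas theorem needed for derivatives of stable forms: the
  logarithmic derivative at 0 is the sum of \<open>- 1 / r\<close> over the roots, and every summand has negative
  imaginary part.
\<close>

lemma pderiv_0_nonzero_if_roots_lower:
  fixes f :: "complex poly"
  assumes "degree f \<noteq> 0" "\<And>r. poly f r = 0 \<Longrightarrow> Im r < 0"
  shows "poly (pderiv f) 0 \<noteq> 0"
proof -
  define m where "m = degree f"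
  obtain r where r: "smult (lead_coeff f) (\<Prod>i<m. [:- r i, 1:]) = f"
    using complex_poly_decompose'[of f] m_def by auto
  have f: "poly f u = lead_coeff f * (\<Prod>i<m. - r i + u * 1)" for u
    by (subst r[symmetric]) (simp add: poly_prod)
  have lc: "lead_coeff f \<noteq> 0"
    using assms(1) by auto
  have Im_r: "Im (r i) < 0" if "i < m" for i
    by (rule assms(2)) (use that in \<open>auto simp: f intro!: bexI[of _ i]\<close>)
  then have r0: "- r i \<noteq> 0" if "i < m" for i
    using that by fastforce
  have "((\<lambda>u. lead_coeff f * (\<Prod>i<m. - r i + u * 1)) has_field_derivative
      lead_coeff f * ((\<Prod>i<m. - r i) * (\<Sum>i<m. 1 / - r i))) (at 0)"
    by (intro DERIV_cmult has_field_derivative_prod_affine r0)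
  then have "(poly f has_field_derivative
      lead_coeff f * ((\<Prod>i<m. - r i) * (\<Sum>i<m. 1 / - r i))) (at 0)"
    unfolding f[symmetric] by simp
  then have eq: "poly (pderiv f) 0 = lead_coeff f * ((\<Prod>i<m. - r i) * (\<Sum>i<m. 1 / - r i))"
    using poly_DERIV DERIV_unique by blast
  have "(\<Sum>i<m. Im (1 / - r i)) < (\<Sum>i<m. 0)"
  proof (rule sum_strict_mono)
    show "{..<m} \<noteq> {}" using assms(1) by (auto simp: m_def lessThan_empty_iff)
    fix i assume "i \<in> {..<m}"
    then have "Im (r i) < 0" using Im_r by simp
    then have "0 < (Re (r i))\<^sup>2 + (Im (r i))\<^sup>2"
      by (simp add: add_nonneg_pos)
    with \<open>Im (r i) < 0\<close> show "Im (1 / - r i) < 0"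
      by (simp add: Im_divide divide_neg_pos)
  qed auto
  then have "(\<Sum>i<m. 1 / - r i) \<noteq> 0"
    by (metis Im_sum less_irrefl sum.neutral_const zero_complex.sel(2))
  then show ?thesis
    unfolding eq using lc r0 by simp
qed

text \<open>
  The numbers \<open>l i\<close> are the negated reciprocals of the roots.
\<close>

lemma poly_with_negative_roots:
  fixes f :: "complex poly"
  assumes "\<And>r. poly f r = 0 \<Longrightarrow> r \<in> \<real> \<and> Re r < 0"
  shows "\<exists>l. (\<forall>i<degree f. 0 < l i) \<and>
           (\<forall>s. poly f s = poly f 0 * (\<Prod>i<degree f. 1 + s * of_real (l i)))"
proof -
  define m where "m = degree f"
  obtain r where r: "smult (lead_coeff f) (\<Prod>i<m. [:- r i, 1:]) = f"
    using complex_poly_decompose'[of f] m_def by auto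
  have f: "poly f u = lead_coeff f * (\<Prod>i<m. u - r i)" for u
    by (subst r[symmetric]) (simp add: poly_prod)
  have root: "r i \<in> \<real> \<and> Re (r i) < 0" if "i < m" for i
    by (rule assms) (use that in \<open>auto simp: f\<close>)
  have "s - r i = - r i * (1 + s * of_real (- (1 / Re (r i))))" if "i < m" for s i
  proof -
    from root[OF that] obtain a where a: "r i = of_real a" by (auto elim: Reals_cases)
    then have "a \<noteq> 0" using root[OF that] by auto
    then show ?thesis by (simp add: a field_simps)
  qed
  then have "(\<Prod>i<m. s - r i) = (\<Prod>i<m. - r i) * (\<Prod>i<m. 1 + s * of_real (- (1 / Re (r i))))" for s
    by (simp add: prod.distrib[symmetric])
  then have "poly f s = poly f 0 * (\<Prod>i<m. 1 + s * of_real (- (1 / Re (r i))))" for s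
    by (simp add: f)
  moreover have "0 < - (1 / Re (r i))" if "i < m" for i
    using root[OF that] by (simp add: divide_pos_neg)
  ultimately show ?thesis
    unfolding m_def by (intro exI[of _ "\<lambda>i. - (1 / Re (r i))"]) blast
qed

lemma poly_eqI_on_reals:
  fixes f g :: "complex poly"
  assumes "\<And>t. poly f (of_real t) = poly g (of_real t)"
  shows "f = g"
proof -
  have "range of_real \<subseteq> {u. poly (f - g) u = 0}" using assms by auto
  moreover have "infinite (range complex_of_real)"
    by (simp add: infinite_UNIV_char_0 finite_image_iff inj_on_def)
  ultimately have "f - g = 0"
    using poly_roots_finite[of "f - g"] finite_subset by blast
  then show ?thesis by simp
qed

lemma proots_factorization:
  fixes r :: "'a :: field poly"
  assumes "size (proots r) = degree r"
  shows "r = smult (lead_coeff r) (\<Prod>a\<in>#proots r. [:- a, 1:])"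
  using assms
proof (induction r rule: poly_root_order_induct)
  case (no_roots r)
  then have "r \<noteq> 0" by auto
  then have "set_mset (proots r) = {}" using no_roots by (simp add: set_count_proots)
  then have "proots r = {#}" by simp
  with no_roots.prems have "degree r = 0" by simp
  then show ?case by (auto elim!: degree_eq_zeroE)
next
  case (root r x k)
  then have r0: "r \<noteq> 0" by auto
  have pr: "proots ([:- x, 1:] ^ k * r) = repeat_mset k {#x#} + proots r"
    using r0 by (simp add: proots_mult proots_power)
  have "degree ([:- x, 1:] ^ k * r) = k + degree r"
    using r0 by (simp add: degree_mult_eq degree_power_eq)
  with root.prems pr have "size (proots r) = degree r" by simp
  from root.IH[OF this] have IH: "r = smult (lead_coeff r) (\<Prod>a\<in>#proots r. [:- a, 1:])" .
  have lc: "lead_coeff ([:- x, 1:] ^ k * r) = lead_coeff r"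
    by (simp add: lead_coeff_mult lead_coeff_power)
  have "(\<Prod>a\<in>#repeat_mset k {#x#}. [:- a, 1:]) = [:- x, 1:] ^ k"
    by (induction k) auto
  then have prod: "(\<Prod>a\<in>#proots ([:- x, 1:] ^ k * r). [:- a, 1:]) =
      [:- x, 1:] ^ k * (\<Prod>a\<in>#proots r. [:- a, 1:])"
    unfolding pr by simp
  show ?case
    unfolding prod lc mult_smult_right[symmetric] by (rule arg_cong[OF IH])
qed simp

section \<open>Stable forms and their derivatives\<close>

text \<open>
  For positive \<open>y\<close> the inequality says that \<open>t \<mapsto> p (x + t y)\<close> has only real roots: by homogeneity
  it amounts to \<open>\<bar>p (x + t y)\<bar> \<ge> p y * \<bar>Im t\<bar> ^ d\<close>, which holds when all roots are real and excludes
  any other root. In this form hyperbolicity passes to pointwise limits.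
\<close>

definition stable_form :: "nat \<Rightarrow> nat \<Rightarrow> ((nat \<Rightarrow> complex) \<Rightarrow> complex) \<Rightarrow> bool" where
  "stable_form n d p \<longleftrightarrow> real_form n d p \<and>
     (\<forall>x y. (\<forall>i\<in>{1..n}. 0 < y i) \<longrightarrow>
        0 < Re (p (cvec y)) \<and> Re (p (cvec y)) \<le> cmod (p (\<lambda>i. Complex (x i) (y i))))"

lemma stable_form_pos:
  "stable_form n d p \<Longrightarrow> (\<forall>i\<in>{1..n}. 0 < y i) \<Longrightarrow> 0 < Re (p (cvec y))"
  unfolding stable_form_def by blast

lemma stable_form_nonzero:
  assumes "stable_form n d p" "\<forall>i\<in>{1..n}. 0 < Im (z i)"
  shows "p z \<noteq> 0"
proof -
  have *: "0 < Re (p (cvec y)) \<and> Re (p (cvec y)) \<le> cmod (p (\<lambda>i. Complex (x i) (y i)))"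
    if "\<forall>i\<in>{1..n}. 0 < y i" for x y
    using assms(1) that unfolding stable_form_def by blast
  show ?thesis
    using *[OF assms(2), of "\<lambda>i. Re (z i)"] by auto
qed

text \<open>
  For non-real \<open>s\<close> some coordinates of \<open>y + s v\<close> may be real, since \<open>v\<close> may lie on the boundary of the
  orthant. After division by \<open>s\<close> the vector becomes \<open>v + y / s\<close>, whose imaginary parts are non-zero
  and all of the same sign.
\<close>

lemma stable_form_ray_nonzero:
  assumes p: "stable_form n d p" and y: "\<forall>i\<in>{1..n}. 0 < y i"
    and v: "\<forall>i\<in>{1..n}. 0 \<le> v i" and s: "\<not> (s \<in> \<real> \<and> Re s < 0)"
  shows "p (\<lambda>i. cvec y i + s * cvec v i) \<noteq> 0"
proof (cases "s \<in> \<real>")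
  case True
  then obtain a where a: "s = of_real a" by (auto elim: Reals_cases)
  have "0 < Re (p (cvec (\<lambda>i. y i + a * v i)))"
    by (rule stable_form_pos[OF p]) (use y v s a in \<open>auto intro: add_pos_nonneg\<close>)
  moreover have "(\<lambda>i. cvec y i + s * cvec v i) = cvec (\<lambda>i. y i + a * v i)"
    by (auto simp: cvec_def a)
  ultimately show ?thesis by auto
next
  case False
  then have Im_s: "Im s \<noteq> 0" and s0: "s \<noteq> 0" by (auto simp: complex_is_Real_iff)
  have rf: "real_form n d p" using p by (simp add: stable_form_def)
  define w where "w = (\<lambda>i. cvec v i + inverse s * cvec y i)"
  have "(\<lambda>i. cvec y i + s * cvec v i) = (\<lambda>i. s * w i)"
    using s0 by (auto simp: w_def field_simps)
  then have eq: "p (\<lambda>i. cvec y i + s * cvec v i) = s ^ d * p w"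
    using real_form_homogeneous[OF rf, of s w] by simp
  have Im_w: "Im (w i) = Im (inverse s) * y i" for i
    by (simp add: w_def cvec_def)
  have "p w \<noteq> 0"
  proof (cases "Im (inverse s) > 0")
    case True
    then have "\<forall>i\<in>{1..n}. 0 < Im (w i)"
      using y by (metis Im_w mult_pos_pos)
    then show ?thesis
      by (rule stable_form_nonzero[OF p])
  next
    case False
    moreover have "Im (inverse s) \<noteq> 0" using Im_s by (simp add: complex_eq_iff)
    ultimately have "Im (inverse s) < 0" by (metis linorder_neqE)
    then have "\<forall>i\<in>{1..n}. 0 < Im (cnj (w i))"
      using y by (metis Im_w cnj.sel(2) mult_neg_pos neg_0_less_iff_less)
    then have "p (\<lambda>i. cnj (w i)) \<noteq> 0"
      by (rule stable_form_nonzero[OF p])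
    then show ?thesis
      using real_form_cnj[OF rf, of w] by auto
  qed
  then show ?thesis unfolding eq using s0 by simp
qed

text \<open>
  By the previous lemma all roots of the restriction to the line are real and negative; the \<open>l i\<close> are
  their negated reciprocals. The polynomial \<open>f\<close> is exported because its degree, the number of
  factors, is determined in different ways: by its coefficient in degree \<open>d\<close> when \<open>v\<close> is positive,
  and by a vanishing iterated derivative along \<open>v\<close> when a rank bound is at hand.
\<close>

lemma stable_form_ray:
  assumes p: "stable_form n d p" and y: "\<forall>i\<in>{1..n}. 0 < y i"
    and v: "\<forall>i\<in>{1..n}. 0 \<le> v i"
  obtains f l where "degree f \<le> d" "coeff f d = p (cvec v)"
    "\<And>s. poly f s = p (\<lambda>i. cvec y i + s * cvec v i)"
    "\<And>i. i < degree f \<Longrightarrow> 0 < l i"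
    "\<And>s. Re (p (cvec (\<lambda>i. y i + s * v i))) =
      Re (p (cvec y)) * (\<Prod>i<degree f. 1 + s * l i)"
    "Re (dir_deriv v p (cvec y)) = Re (p (cvec y)) * (\<Sum>i<degree f. l i)"
proof -
  have rf: "real_form n d p" using p by (simp add: stable_form_def)
  obtain f where f: "degree f \<le> d" "coeff f d = p (cvec v)"
      "\<And>s. poly f s = p (\<lambda>i. cvec y i + s * cvec v i)"
    using real_form_line[OF rf, of "cvec v" "cvec y"] by blast
  have "r \<in> \<real> \<and> Re r < 0" if "poly f r = 0" for r
    using that stable_form_ray_nonzero[OF p y v, of r] f(3)[of r] by argo
  then obtain l where l: "\<And>i. i < degree f \<Longrightarrow> 0 < l i"
      "\<And>s. poly f s = poly f 0 * (\<Prod>i<degree f. 1 + s * of_real (l i))"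
    using poly_with_negative_roots[of f] by blast
  have f0: "poly f 0 = p (cvec y)" by (simp add: f(3))
  have prod: "p (\<lambda>i. cvec y i + s * cvec v i) =
      p (cvec y) * (\<Prod>i<degree f. 1 + s * of_real (l i))" for s
    unfolding f(3)[symmetric] f0[symmetric] by (rule l(2))
  have "p (cvec (\<lambda>i. y i + s * v i)) =
      of_real (Re (p (cvec y)) * (\<Prod>i<degree f. 1 + s * l i))" for s
  proof -
    have "p (cvec (\<lambda>i. y i + s * v i)) = p (\<lambda>i. cvec y i + of_real s * cvec v i)"
      by (simp add: cvec_def)
    then show ?thesis
      unfolding prod by (subst (asm) real_form_real[OF rf]) simp
  qed
  then have re: "Re (p (cvec (\<lambda>i. y i + s * v i))) =
      Re (p (cvec y)) * (\<Prod>i<degree f. 1 + s * l i)" for s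
    by (simp only: Re_complex_of_real)
  have "((\<lambda>s. \<Prod>i<degree f. 1 + s * complex_of_real (l i)) has_field_derivative
      (\<Prod>i<degree f. 1) * (\<Sum>i<degree f. of_real (l i) / 1)) (at 0)"
    by (rule has_field_derivative_prod_affine) simp
  from DERIV_cmult[OF this, of "p (cvec y)"]
  have "((\<lambda>s. p (\<lambda>i. cvec y i + s * cvec v i)) has_field_derivative
      p (cvec y) * (\<Sum>i<degree f. of_real (l i))) (at 0)"
    by (simp add: prod)
  moreover have "((\<lambda>s. p (\<lambda>i. cvec y i + s * cvec v i)) has_field_derivative
      dir_deriv v p (cvec y)) (at 0)"
    using dir_deriv_at[OF rf, of "cvec y" v] by (simp add: cvec_def)
  ultimately have "dir_deriv v p (cvec y) = p (cvec y) * (\<Sum>i<degree f. of_real (l i))"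
    using DERIV_unique by blast
  then have "Re (dir_deriv v p (cvec y)) = Re (p (cvec y)) * (\<Sum>i<degree f. l i)"
    by (simp flip: of_real_sum)
  then show ?thesis
    using that[of f l] f l(1) prod re by simp
qed

lemma stable_form_mono:
  assumes p: "stable_form n d p" and y: "\<forall>i\<in>{1..n}. 0 < y i"
    and v: "\<forall>i\<in>{1..n}. 0 \<le> v i"
  shows "Re (p (cvec y)) \<le> Re (p (cvec (\<lambda>i. y i + v i)))"
proof -
  obtain f :: "complex poly" and l where l: "\<And>i. i < degree f \<Longrightarrow> 0 < l i"
      and eq: "\<And>s. Re (p (cvec (\<lambda>i. y i + s * v i))) =
        Re (p (cvec y)) * (\<Prod>i<degree f. 1 + s * l i)"
    by (rule stable_form_ray[OF p y v]) blast+
  have "1 \<le> (\<Prod>i<degree f. 1 + 1 * l i)"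
    by (rule prod_ge_1) (use l in \<open>auto simp: less_imp_le\<close>)
  then have "Re (p (cvec y)) * 1 \<le> Re (p (cvec y)) * (\<Prod>i<degree f. 1 + 1 * l i)"
    using stable_form_pos[OF p y] by (intro mult_left_mono) (auto simp: less_imp_le)
  then show ?thesis using eq[of 1] by simp
qed

text \<open>
  The value in the positive direction \<open>v\<close> is not zero, so that \<open>s \<mapsto> p (z + s v)\<close> has full degree. If
  \<open>z\<close> has positive imaginary parts, all its roots lie in the lower half-plane, and the derivative at
  \<open>s = 0\<close> cannot vanish. Hence the derivative has no zeros there, and the quantitative inequality
  follows from \<open>norm_poly_ge_Im_power\<close>.
\<close>

lemma stable_form_dir_deriv_interior:
  assumes p: "stable_form n d p" and d: "d \<noteq> 0" and v: "\<forall>i\<in>{1..n}. 0 < v i"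
  shows "stable_form n (d - 1) (dir_deriv v p)"
proof -
  have rf: "real_form n d p" using p by (simp add: stable_form_def)
  have rf': "real_form n (d - 1) (dir_deriv v p)" by (rule real_form_dir_deriv[OF rf])
  have vpos: "p (cvec v) \<noteq> 0" using stable_form_pos[OF p v] by auto
  show ?thesis
    unfolding stable_form_def
  proof (intro conjI allI impI)
    fix x y :: "nat \<Rightarrow> real" assume y: "\<forall>i\<in>{1..n}. 0 < y i"
    have v': "\<forall>i\<in>{1..n}. 0 \<le> v i" using v by (auto simp: less_imp_le)
    obtain f l where fl: "degree f \<le> d" "coeff f d = p (cvec v)"
        "\<And>i. i < degree f \<Longrightarrow> 0 < l i"
        "Re (dir_deriv v p (cvec y)) = Re (p (cvec y)) * (\<Sum>i<degree f. l i)"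
      by (rule stable_form_ray[OF p y v']) blast+
    have "degree f = d" using fl(1,2) vpos le_degree[of f d] by auto
    then have "0 < (\<Sum>i<degree f. l i)"
      using d fl(3) by (intro sum_pos) auto
    then show pos: "0 < Re (dir_deriv v p (cvec y))"
      using fl(4) stable_form_pos[OF p y] by simp
    have nz: "dir_deriv v p z \<noteq> 0" if z: "\<forall>i\<in>{1..n}. 0 < Im (z i)" for z
    proof -
      obtain g where g: "degree g \<le> d" "coeff g d = p (cvec v)"
        "\<And>s. poly g s = p (\<lambda>i. z i + s * cvec v i)"
        using real_form_line[OF rf, of "cvec v" z] by blast
      have "degree g = d" using g(1,2) vpos le_degree[of g d] by auto
      have "Im r < 0" if "poly g r = 0" for r
      proof (rule ccontr)
        assume "\<not> Im r < 0"
        then have "p (\<lambda>i. z i + r * cvec v i) \<noteq> 0"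
          by (intro stable_form_nonzero[OF p])
             (use z v in \<open>auto simp: cvec_def not_less less_imp_le intro!: add_pos_nonneg mult_nonneg_nonneg\<close>)
        with that g(3) show False by simp
      qed
      then have "poly (pderiv g) 0 \<noteq> 0"
        using \<open>degree g = d\<close> d by (intro pderiv_0_nonzero_if_roots_lower) auto
      moreover have "(poly g has_field_derivative dir_deriv v p z) (at 0)"
      proof -
        have "poly g = (\<lambda>s. p (\<lambda>i. z i + s * of_real (v i)))"
          using g(3) by (auto simp: cvec_def)
        then show ?thesis using dir_deriv_at[OF rf, of z v] by simp
      qed
      ultimately show ?thesis
        using poly_DERIV[of g 0] DERIV_unique by metis
    qed
    obtain g where g: "degree g \<le> d - 1" "coeff g (d - 1) = dir_deriv v p (cvec y)"
      "\<And>s. poly g s = dir_deriv v p (\<lambda>i. cvec x i + s * cvec y i)"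
      using real_form_line[OF rf', of "cvec y" "cvec x"] by blast
    have "cmod (coeff g (d - 1)) * Im \<i> ^ (d - 1) \<le> cmod (poly g \<i>)"
    proof (rule norm_poly_ge_Im_power[OF g(1)])
      fix r assume "poly g r = 0"
      then show "Im r \<le> 0"
        using nz[of "\<lambda>i. cvec x i + r * cvec y i"] g(3)[of r] y
        by (force simp: cvec_def not_le)
    qed simp
    moreover have "(\<lambda>i. cvec x i + \<i> * cvec y i) = (\<lambda>i. Complex (x i) (y i))"
      by (auto simp: cvec_def complex_eq_iff)
    ultimately have "cmod (dir_deriv v p (cvec y)) \<le> cmod (dir_deriv v p (\<lambda>i. Complex (x i) (y i)))"
      using g(2,3) by simp
    then show "Re (dir_deriv v p (cvec y)) \<le> cmod (dir_deriv v p (\<lambda>i. Complex (x i) (y i)))"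
      using complex_Re_le_cmod order_trans by blast
  qed (rule rf')
qed

text \<open>
  A line through the vector of ones stays inside the positive orthant for a while, so the form
  vanishes on the whole line, and so does its coefficient in degree \<open>d\<close>, the value in the direction
  of the line. This covers the real vectors; a complex vector lies on the complexification of a
  real line.
\<close>

lemma real_form_eq_0:
  assumes rf: "real_form n d p"
    and 0: "\<And>y. (\<forall>i\<in>{1..n}. 0 < y i) \<Longrightarrow> Re (p (cvec y)) = 0"
  shows "p = (\<lambda>z. 0)"
proof
  fix z :: "nat \<Rightarrow> complex"
  have real: "p (cvec x) = 0" for x
  proof -
    obtain f where f: "coeff f d = p (cvec x)" "\<And>s. poly f s = p (\<lambda>i. cvec (\<lambda>_. 1) i + s * cvec x i)"
      using real_form_line[OF rf, of "cvec x" "cvec (\<lambda>_. 1)"] by blast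
    \<comment> \<open>for \<open>s \<le> e\<close> the vector \<open>(1, \<dots>, 1) + s x\<close> is still positive\<close>
    define e where "e = 1 / (1 + (\<Sum>i=1..n. \<bar>x i\<bar>))"
    have S: "0 \<le> (\<Sum>i=1..n. \<bar>x i\<bar>)" by (simp add: sum_nonneg)
    then have "e > 0" by (simp add: e_def add_pos_nonneg)
    have "poly f (of_real s) = 0" if s: "s \<in> {0..e}" for s
    proof -
      have "0 < 1 + s * x i" if i: "i \<in> {1..n}" for i
      proof -
        have "\<bar>s * x i\<bar> \<le> e * (\<Sum>i=1..n. \<bar>x i\<bar>)"
          unfolding abs_mult using s i S member_le_sum[of i "{1..n}" "\<lambda>i. \<bar>x i\<bar>"]
          by (intro mult_mono) auto
        also have "\<dots> < 1" using S by (simp add: e_def divide_less_eq not_less)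
        finally show ?thesis by linarith
      qed
      then have "Re (p (cvec (\<lambda>i. 1 + s * x i))) = 0" by (intro 0) blast
      then have "p (cvec (\<lambda>i. 1 + s * x i)) = 0"
        using real_form_real[OF rf] by (metis of_real_0)
      moreover have "(\<lambda>i. cvec (\<lambda>_. 1) i + of_real s * cvec x i) = cvec (\<lambda>i. 1 + s * x i)"
        by (simp add: cvec_def)
      ultimately show ?thesis by (simp add: f(2))
    qed
    then have "of_real ` {0..e} \<subseteq> {u. poly f u = 0}" by auto
    moreover have "infinite (complex_of_real ` {0..e})"
      using \<open>e > 0\<close> by (subst finite_image_iff) (auto simp: inj_on_def)
    ultimately have "f = 0"
      using poly_roots_finite[of f] finite_subset by blast
    then show ?thesis using f(1) by simp
  qed
  define x y where "x = (\<lambda>i. Re (z i))" and "y = (\<lambda>i. Im (z i))"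
  obtain f where f: "\<And>s. poly f s = p (\<lambda>i. cvec x i + s * cvec y i)"
    using real_form_line[OF rf, of "cvec y" "cvec x"] by blast
  have "f = 0"
    by (rule poly_eqI_on_reals) (use real[of "\<lambda>i. x i + _ * y i"] in \<open>simp add: f cvec_def\<close>)
  moreover have "(\<lambda>i. cvec x i + \<i> * cvec y i) = z"
    by (auto simp: cvec_def x_def y_def complex_eq_iff)
  ultimately show "p z = 0" using f[of \<i>] by simp
qed

text \<open>
  The derivative \<open>r\<close> along \<open>v\<close> is the limit of the derivatives along the positive directions
  \<open>v + a (1, \<dots>, 1)\<close>, so it inherits all inequalities in weak form. It remains to see that \<open>r\<close> is
  strictly positive on the orthant or vanishes identically: as \<open>r\<close> is monotone and
  homogeneous, a zero at one positive vector forces zeros at all smaller ones, and by scaling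
  at all positive vectors.
\<close>

lemma stable_form_dir_deriv_boundary:
  assumes p: "stable_form n d p" and d: "d \<noteq> 0" and v: "\<forall>i\<in>{1..n}. 0 \<le> v i"
  shows "dir_deriv v p = (\<lambda>z. 0) \<or> stable_form n (d - 1) (dir_deriv v p)"
proof -
  have rf: "real_form n d p" using p by (simp add: stable_form_def)
  define r where "r = dir_deriv v p"
  have rf': "real_form n (d - 1) r" unfolding r_def by (rule real_form_dir_deriv[OF rf])
  define e where "e = dir_deriv (\<lambda>_. 1) p"
  have st: "stable_form n (d - 1) (\<lambda>z. r z + of_real a * e z)" if "a > 0" for a
  proof -
    have "dir_deriv (\<lambda>i. v i + a * 1) p = (\<lambda>z. r z + of_real a * e z)"
      unfolding r_def e_def using dir_deriv_linear[OF rf, of v a "\<lambda>_. 1"] by auto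
    moreover have "stable_form n (d - 1) (dir_deriv (\<lambda>i. v i + a * 1) p)"
      by (rule stable_form_dir_deriv_interior[OF p d]) (use v that in \<open>auto intro: add_nonneg_pos\<close>)
    ultimately show ?thesis by simp
  qed
  have lim: "((\<lambda>a. r z + of_real a * e z) \<longlongrightarrow> r z) (at_right 0)" for z
    by (rule tendsto_eq_intros refl | simp)+
  have limRe: "((\<lambda>a. Re (r z + of_real a * e z)) \<longlongrightarrow> Re (r z)) (at_right 0)" for z
    by (intro tendsto_Re lim)
  have ev: "\<forall>\<^sub>F a in at_right (0::real). a > 0"
    by (simp add: eventually_at_right_less)
  have nonneg: "0 \<le> Re (r (cvec y))" if "\<forall>i\<in>{1..n}. 0 < y i" for y
  proof (rule tendsto_lowerbound[OF limRe])
    show "\<forall>\<^sub>F a in at_right 0. 0 \<le> Re (r (cvec y) + of_real a * e (cvec y))"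
      using ev by eventually_elim (use stable_form_pos[OF st that] in \<open>force simp: less_imp_le\<close>)
  qed simp
  have bound: "Re (r (cvec y)) \<le> cmod (r (\<lambda>i. Complex (x i) (y i)))"
    if "\<forall>i\<in>{1..n}. 0 < y i" for x y
  proof (rule tendsto_le[OF _ tendsto_norm[OF lim] limRe])
    show "\<forall>\<^sub>F a in at_right 0. Re (r (cvec y) + of_real a * e (cvec y))
        \<le> cmod (r (\<lambda>i. Complex (x i) (y i)) + of_real a * e (\<lambda>i. Complex (x i) (y i)))"
      using ev by eventually_elim (use st that in \<open>auto simp: stable_form_def\<close>)
  qed simp
  have mono: "Re (r (cvec y)) \<le> Re (r (cvec (\<lambda>i. y i + w i)))"
    if "\<forall>i\<in>{1..n}. 0 < y i" "\<forall>i\<in>{1..n}. 0 \<le> w i" for y w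
  proof (rule tendsto_le[OF _ limRe limRe])
    show "\<forall>\<^sub>F a in at_right 0. Re (r (cvec y) + of_real a * e (cvec y))
        \<le> Re (r (cvec (\<lambda>i. y i + w i)) + of_real a * e (cvec (\<lambda>i. y i + w i)))"
      using ev by eventually_elim (use stable_form_mono[OF st that] in auto)
  qed simp
  show ?thesis
  proof (cases "\<exists>y. (\<forall>i\<in>{1..n}. 0 < y i) \<and> Re (r (cvec y)) = 0")
    case False
    then have "stable_form n (d - 1) r"
      unfolding stable_form_def using rf' bound nonneg by (metis less_eq_real_def)
    then show ?thesis unfolding r_def ..
  next
    case True
    then obtain y where y: "\<forall>i\<in>{1..n}. 0 < y i" "Re (r (cvec y)) = 0"
      by blast
    have "Re (r (cvec w)) = 0" if w: "\<forall>i\<in>{1..n}. 0 < w i" for w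
    proof -
      \<comment> \<open>chosen so large that \<open>w \<le> b y\<close> in every coordinate\<close>
      define b where "b = (\<Sum>i=1..n. w i / y i) + 1"
      have S: "0 \<le> (\<Sum>i=1..n. w i / y i)"
        by (intro sum_nonneg divide_nonneg_nonneg) (use w y in \<open>auto simp: less_imp_le\<close>)
      then have b: "b > 0" by (simp add: b_def)
      have "w i \<le> b * y i" if i: "i \<in> {1..n}" for i
      proof -
        have "w i / y i \<le> b"
          unfolding b_def using member_le_sum[of i "{1..n}" "\<lambda>i. w i / y i"] w y i
          by (force simp: less_imp_le intro!: divide_nonneg_nonneg)
        then show ?thesis using bspec[OF y(1) i] by (simp add: divide_le_eq)
      qed
      then have "Re (r (cvec w)) \<le> Re (r (cvec (\<lambda>i. w i + (b * y i - w i))))"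
        by (intro mono w) auto
      also have "r (cvec (\<lambda>i. w i + (b * y i - w i))) = of_real b ^ (d - 1) * r (cvec y)"
        using real_form_homogeneous[OF rf', of "of_real b" "cvec y"] by (simp add: cvec_def)
      also have "Re \<dots> = 0"
        using y(2) by (simp flip: of_real_power)
      finally show ?thesis using nonneg[OF w] by simp
    qed
    then have "r = (\<lambda>z. 0)" by (rule real_form_eq_0[OF rf'])
    then show ?thesis by (simp add: r_def)
  qed
qed

section \<open>The capacity inequality for one derivative\<close>

lemma g_factor_nonneg: "0 \<le> g_factor k"
  unfolding g_factor_def by (cases k) auto

text \<open>
  The inequality of arithmetic and geometric means for \<open>k\<close> numbers, the missing ones being 1. It is
  proved by dividing by the mean \<open>a\<close> and multiplying the inequalities \<open>u \<le> exp (u - 1)\<close>.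
\<close>

lemma prod_affine_le_power_mean:
  fixes l :: "nat \<Rightarrow> real"
  assumes k: "1 \<le> k" "m \<le> k" and l: "\<And>i. i < m \<Longrightarrow> 0 \<le> l i" and t: "0 \<le> t"
  shows "(\<Prod>i<m. 1 + t * l i) \<le> (1 + t * (\<Sum>i<m. l i) / k) ^ k"
proof -
  define l' where "l' i = (if i < m then l i else 0)" for i
  define a where "a = 1 + t * (\<Sum>i<m. l i) / k"
  have sub: "{..<k} \<inter> {i. i < m} = {..<m}" using k by auto
  have sum: "(\<Sum>i<k. l' i) = (\<Sum>i<m. l i)"
    by (simp add: l'_def sum.If_cases sub)
  have "(\<Prod>i<k. 1 + t * l' i) = (\<Prod>i<k. if i < m then 1 + t * l i else 1)"
    by (intro prod.cong) (auto simp: l'_def)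
  then have prod: "(\<Prod>i<k. 1 + t * l' i) = (\<Prod>i<m. 1 + t * l i)"
    by (simp add: prod.If_cases sub)
  have "0 \<le> (\<Sum>i<m. l i)" using l by (intro sum_nonneg) auto
  then have a: "0 < a" unfolding a_def using t k by (intro add_pos_nonneg) auto
  have "(\<Prod>i<k. (1 + t * l' i) / a) \<le> (\<Prod>i<k. exp ((1 + t * l' i) / a - 1))"
  proof (intro prod_mono conjI)
    fix i
    show "0 \<le> (1 + t * l' i) / a" using a t l by (auto simp: l'_def)
    show "(1 + t * l' i) / a \<le> exp ((1 + t * l' i) / a - 1)"
      using exp_ge_add_one_self[of "(1 + t * l' i) / a - 1"] by simp
  qed
  also have "\<dots> = exp (\<Sum>i<k. (1 + t * l' i) / a - 1)"
    by (simp add: exp_sum)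
  also have "(\<Sum>i<k. (1 + t * l' i) / a - 1) = (k + t * (\<Sum>i<m. l i)) / a - k"
    by (simp add: sum_subtractf sum.distrib flip: sum_divide_distrib sum_distrib_left sum)
  also have "\<dots> = 0"
    using a k by (simp add: a_def field_simps)
  finally have "(\<Prod>i<k. 1 + t * l' i) / a ^ k \<le> 1"
    by (simp add: prod_dividef)
  then show ?thesis
    using a by (simp add: prod a_def divide_le_eq)
qed

text \<open>
  For \<open>k \<ge> 2\<close> the upper bound \<open>c * (1 + t * S / k) ^ k\<close> is compared with \<open>C * t\<close> at
  \<open>t = k / ((k - 1) * S)\<close>, where the quotient of the two is smallest. In the other cases letting \<open>t\<close> grow
  suffices.
\<close>

lemma linear_bound_imp_slope_bound:
  fixes l :: "nat \<Rightarrow> real"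
  assumes m: "m \<le> k" and l: "\<And>i. i < m \<Longrightarrow> 0 \<le> l i" and c: "0 < c" and C: "0 \<le> C"
    and bound: "\<And>t. 0 < t \<Longrightarrow> C * t \<le> c * (\<Prod>i<m. 1 + t * l i)"
  shows "g_factor k * C \<le> c * (\<Sum>i<m. l i)"
proof -
  define S where "S = (\<Sum>i<m. l i)"
  have S: "0 \<le> S" unfolding S_def using l by (intro sum_nonneg) auto
  have le: "C * t \<le> c * (1 + t * S / k) ^ k" if "0 < t" "1 \<le> k" for t
  proof -
    have "C * t \<le> c * (\<Prod>i<m. 1 + t * l i)" using bound[OF that(1)] .
    also have "\<dots> \<le> c * (1 + t * S / k) ^ k"
      unfolding S_def using that c l by (intro mult_left_mono prod_affine_le_power_mean m) auto
    finally show ?thesis .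
  qed
  have "k = 0 \<Longrightarrow> S = 0" using m by (simp add: S_def)
  then have "S = 0 \<or> (S > 0 \<and> k = 1) \<or> (S > 0 \<and> k \<ge> 2)"
    using S by (cases "k = 0"; cases "k = 1") auto
  then consider "S = 0" | "S > 0" "k = 1" | "S > 0" "k \<ge> 2"
    by blast
  then have "g_factor k * C \<le> c * S"
  proof cases
    case 1
    then have "l i = 0" if "i < m" for i
      using that l unfolding S_def by (subst (asm) sum_nonneg_eq_0_iff) auto
    then have *: "C * t \<le> c" if "0 < t" for t
      using bound[OF that] by simp
    have "C = 0"
    proof (rule ccontr)
      assume "C \<noteq> 0"
      then show False using *[of "2 * c / C"] C c by simp
    qed
    then show ?thesis using 1 by simp
  next
    case 2
    have "C \<le> c * S"
    proof (rule ccontr)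
      assume "\<not> C \<le> c * S"
      then have pos: "0 < C - c * S" by simp
      define t where "t = 2 * c / (C - c * S)"
      have "C * t \<le> c * (1 + t * S)" using le[of t] 2 pos c by (simp add: t_def)
      then have "(C - c * S) * t \<le> c" by (simp add: algebra_simps)
      then show False using pos c by (simp add: t_def)
    qed
    then show ?thesis using 2 by (simp add: g_factor_def)
  next
    case 3
    then obtain j where j: "k = Suc j" "j \<ge> 1" by (cases k) auto
    \<comment> \<open>\<open>b\<close> is the base \<open>(k - 1) / k\<close> of the factor, and the chosen \<open>t\<close> minimises
      \<open>(1 + t * S / k) ^ k / t\<close>\<close>
    define b where "b = real j / real k"
    have b: "0 < b" using j by (simp add: b_def)
    define t where "t = 1 / (b * S)"
    have t: "0 < t" using b 3 by (simp add: t_def)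
    have "t * S = 1 / b" using 3 by (simp add: t_def)
    then have "1 + t * S / k = 1 + 1 / j" using j by (simp add: b_def)
    also have "\<dots> = 1 / b" using j by (simp add: b_def field_simps)
    finally have "1 + t * S / k = 1 / b" .
    then have "C * t \<le> c * (1 / b) ^ k"
      using le[OF t] 3 by simp
    then have "C * t * (b ^ k * S) \<le> c * (1 / b) ^ k * (b ^ k * S)"
      using b S by (intro mult_right_mono) auto
    moreover have "C * t * (b ^ k * S) = C * b ^ j"
      using b 3 j by (simp add: t_def)
    moreover have "c * (1 / b) ^ k * (b ^ k * S) = c * S"
      using b by (simp add: power_divide)
    ultimately have "C * b ^ j \<le> c * S" by simp
    moreover have "g_factor k = b ^ j"
      using j by (simp add: g_factor_def b_def)
    ultimately show ?thesis by (simp add: mult.commute)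
  qed
  then show ?thesis by (simp add: S_def)
qed

lemma higher_pderiv_line:
  assumes "real_form n d p" "\<And>s. poly f s = p (\<lambda>i. z i + s * of_real (v i))"
  shows "poly ((pderiv ^^ j) f) s = (dir_deriv v ^^ j) p (\<lambda>i. z i + s * of_real (v i))"
  using assms
proof (induction j arbitrary: d p f)
  case (Suc j)
  have "poly (pderiv f) s = dir_deriv v p (\<lambda>i. z i + s * of_real (v i))" for s
  proof -
    have "poly f = (\<lambda>s. p (\<lambda>i. z i + s * of_real (v i)))" using Suc.prems(2) by auto
    then show ?thesis
      using poly_DERIV[of f s] real_form_has_deriv[OF Suc.prems(1), of z v s]
      by (auto dest: DERIV_unique)
  qed
  from Suc.IH[OF real_form_dir_deriv[OF Suc.prems(1)] this] show ?case
    by (simp add: funpow_Suc_right del: funpow.simps)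
qed simp

text \<open>
  This turns the vanishing of an iterated directional derivative, which is easily carried
  through further derivatives, into a degree bound on each line.
\<close>

lemma degree_line_le:
  assumes "real_form n d p" "\<And>s. poly f s = p (\<lambda>i. z i + s * of_real (v i))"
    and 0: "(dir_deriv v ^^ Suc k) p = (\<lambda>z. 0)"
  shows "degree f \<le> k"
proof -
  have "poly ((pderiv ^^ Suc k) f) s = 0" for s
    unfolding higher_pderiv_line[OF assms(1,2)] 0 ..
  then have "pderiv ((pderiv ^^ k) f) = 0"
    by (simp add: poly_all_0_iff_0[symmetric])
  then have "degree ((pderiv ^^ k) f) = 0"
    by (simp add: pderiv_eq_0_iff)
  then show ?thesis
    by (simp add: degree_higher_pderiv)
qed

lemma real_form_funpow_dir_deriv:
  "real_form n d p \<Longrightarrow> real_form n (d - k) ((dir_deriv v ^^ k) p)"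
proof (induction k)
  case (Suc k)
  then show ?case using real_form_dir_deriv[of n "d - k" "(dir_deriv v ^^ k) p" v] by simp
qed simp

lemma funpow_dir_deriv_commute:
  assumes "real_form n d p"
  shows "(dir_deriv v ^^ k) (dir_deriv w p) = dir_deriv w ((dir_deriv v ^^ k) p)"
proof (induction k)
  case (Suc k)
  then show ?case
    using dir_deriv_commute[OF real_form_funpow_dir_deriv[OF assms], of v w k v] by simp
qed simp

lemma foldr_dir_deriv_commute:
  assumes "real_form n d p"
  shows "dir_deriv w (foldr (\<lambda>i. dir_deriv (v i)) xs p) =
    foldr (\<lambda>i. dir_deriv (v i)) xs (dir_deriv w p)"
proof (induction xs)
  case (Cons i xs)
  have "\<exists>e. real_form n e (foldr (\<lambda>i. dir_deriv (v i)) xs p)"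
    using assms by (induction xs) (auto intro: real_form_dir_deriv)
  then show ?case
    using Cons dir_deriv_commute[of n _ "foldr (\<lambda>i. dir_deriv (v i)) xs p" w "v i"] by auto
qed simp

text \<open>
  One step of the elimination. Moving from \<open>y\<close> to \<open>y + t e\<^sub>i\<close> multiplies the product over \<open>I\<close> by
  \<open>(y\<^sub>i + t) / y\<^sub>i\<close>, so that the lower bound grows at least linearly in \<open>t\<close>, and the slope bound
  applies to the real-rooted restriction.
\<close>

lemma capacity_dir_deriv:
  assumes p: "stable_form n d p" and i: "i \<in> I" "I \<subseteq> {1..n}" and C: "0 \<le> C"
    and deg: "(dir_deriv (basis_vec i) ^^ Suc R) p = (\<lambda>z. 0)"
    and bound: "\<And>y. \<forall>j\<in>{1..n}. 0 < y j \<Longrightarrow> C * (\<Prod>j\<in>I. y j) \<le> Re (p (cvec y))"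
    and y: "\<forall>j\<in>{1..n}. 0 < y j"
  shows "g_factor (min R d) * C * (\<Prod>j\<in>I - {i}. y j) \<le> Re (dir_deriv (basis_vec i) p (cvec y))"
proof -
  have rf: "real_form n d p" using p by (simp add: stable_form_def)
  have fin: "finite I" using i finite_subset by blast
  define C' where "C' = C * (\<Prod>j\<in>I - {i}. y j)"
  have Pi: "0 \<le> (\<Prod>j\<in>I - {i}. y j)"
    using y i by (intro prod_nonneg) (auto simp: less_imp_le)
  then have C': "0 \<le> C'" using C by (simp add: C'_def)
  have v: "\<forall>j\<in>{1..n}. 0 \<le> basis_vec i j" by (simp add: basis_vec_def)
  obtain f l where f: "degree f \<le> d" "\<And>s. poly f s = p (\<lambda>j. cvec y j + s * cvec (basis_vec i) j)"
    "\<And>j. j < degree f \<Longrightarrow> 0 < l j"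
    "\<And>s. Re (p (cvec (\<lambda>j. y j + s * basis_vec i j))) =
      Re (p (cvec y)) * (\<Prod>i<degree f. 1 + s * l i)"
    "Re (dir_deriv (basis_vec i) p (cvec y)) = Re (p (cvec y)) * (\<Sum>i<degree f. l i)"
    by (rule stable_form_ray[OF p y v]) (rule that)
  have "degree f \<le> R"
    using f(2) by (intro degree_line_le[OF rf _ deg]) (auto simp: cvec_def)
  then have m: "degree f \<le> min R d" using f(1) by simp
  have "g_factor (min R d) * C' \<le> Re (p (cvec y)) * (\<Sum>i<degree f. l i)"
  proof (rule linear_bound_imp_slope_bound[OF m _ stable_form_pos[OF p y] C'])
    show "0 \<le> l j" if "j < degree f" for j using f(3)[OF that] by simp
    fix t :: real assume t: "0 < t"
    define w where "w = (\<lambda>j. y j + t * basis_vec i j)"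
    have "(\<Prod>j\<in>I. w j) = (y i + t) * (\<Prod>j\<in>I - {i}. y j)"
    proof -
      have "(\<Prod>j\<in>I - {i}. w j) = (\<Prod>j\<in>I - {i}. y j)"
        by (intro prod.cong) (auto simp: w_def basis_vec_def)
      then show ?thesis
        using prod.remove[OF fin i(1), of w] by (simp add: w_def basis_vec_def)
    qed
    then have "C * (\<Prod>j\<in>I. w j) = C' * (y i + t)" by (simp add: C'_def)
    moreover have "C' * t \<le> C' * (y i + t)"
      using C' y i by (intro mult_left_mono) (auto intro: less_imp_le)
    moreover have "C * (\<Prod>j\<in>I. w j) \<le> Re (p (cvec w))"
      using y t v by (intro bound) (auto simp: w_def intro!: add_pos_nonneg)
    ultimately show "C' * t \<le> Re (p (cvec y)) * (\<Prod>i<degree f. 1 + t * l i)"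
      using f(4)[of t] unfolding w_def by linarith
  qed
  then show ?thesis by (simp add: f(5) C'_def mult.assoc)
qed

text \<open>
  Here \<open>m\<close> is the degree that is left and \<open>i = n - m + 1\<close> the next variable. The zero
  polynomial is admitted, because a derivative of a stable form may vanish; the assumed bound then
  forces \<open>C = 0\<close>.
\<close>

lemma capacity_elimination:
  assumes "m \<le> n" "real_form n m p" "p = (\<lambda>z. 0) \<or> stable_form n m p" "0 \<le> C"
    and "\<And>y. \<forall>j\<in>{1..n}. 0 < y j \<Longrightarrow> C * (\<Prod>j\<in>{n - m + 1..n}. y j) \<le> Re (p (cvec y))"
    and "\<And>i. i \<in> {1..n} \<Longrightarrow> (dir_deriv (basis_vec i) ^^ Suc (R i)) p = (\<lambda>z. 0)"
  shows "(\<Prod>i=n - m + 1..n. g_factor (min (R i) (n + 1 - i))) * C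
    \<le> Re (foldr (\<lambda>i. dir_deriv (basis_vec i)) [n - m + 1..<Suc n] p (\<lambda>_. 0))"
  using assms
proof (induction m arbitrary: p C)
  case 0
  then obtain c where "p = (\<lambda>z. of_real c)" using real_form_0_const by blast
  then show ?case using "0.prems"(5)[of "\<lambda>_. 1"] by simp
next
  case (Suc m)
  define i where "i = n - m"
  have i: "i \<in> {1..n}" "n - Suc m + 1 = i" "n - m + 1 = Suc i" "n + 1 - i = Suc m"
    using Suc.prems(1) by (auto simp: i_def)
  define I where "I = {i..n}"
  have I: "i \<in> I" "I \<subseteq> {1..n}" "I - {i} = {Suc i..n}" using i(1) by (auto simp: I_def)
  define r where "r = dir_deriv (basis_vec i) p"
  define g where "g = g_factor (min (R i) (Suc m))"
  have g0: "0 \<le> g" unfolding g_def by (rule g_factor_nonneg)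
  have bound: "C * (\<Prod>j\<in>I. y j) \<le> Re (p (cvec y))" if "\<forall>j\<in>{1..n}. 0 < y j" for y
    using Suc.prems(5)[OF that] unfolding i(2) I_def .
  have bound': "g * C * (\<Prod>j\<in>{Suc i..n}. y j) \<le> Re (r (cvec y))" if y: "\<forall>j\<in>{1..n}. 0 < y j" for y
  proof (cases "p = (\<lambda>z. 0)")
    case True
    then have "C = 0" using bound[of "\<lambda>_. 1"] Suc.prems(4) by simp
    then show ?thesis using True by (simp add: r_def dir_deriv_zero)
  next
    case False
    with Suc.prems(3) have "stable_form n (Suc m) p" by blast
    from capacity_dir_deriv[OF this I(1,2) Suc.prems(4) Suc.prems(6)[OF i(1)] bound y]
    show ?thesis by (simp add: g_def r_def I(3))
  qed
  have rf: "real_form n m r" using real_form_dir_deriv[OF Suc.prems(2)] by (simp add: r_def)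
  have "\<forall>j\<in>{1..n}. 0 \<le> basis_vec i j" by (simp add: basis_vec_def)
  then have st: "r = (\<lambda>z. 0) \<or> stable_form n m r"
    using Suc.prems(3) stable_form_dir_deriv_boundary[of n "Suc m" p "basis_vec i"]
    by (auto simp: r_def dir_deriv_zero)
  have deg: "(dir_deriv (basis_vec j) ^^ Suc (R j)) r = (\<lambda>z. 0)" if "j \<in> {1..n}" for j
    unfolding r_def funpow_dir_deriv_commute[OF Suc.prems(2)] Suc.prems(6)[OF that]
    by (rule dir_deriv_zero)
  have "(\<Prod>j=n - m + 1..n. g_factor (min (R j) (n + 1 - j))) * (g * C)
      \<le> Re (foldr (\<lambda>i. dir_deriv (basis_vec i)) [n - m + 1..<Suc n] r (\<lambda>_. 0))"
    by (rule Suc.IH) (use Suc.prems(1,4) rf st g0 bound' deg i(3) in auto)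
  moreover have "(\<Prod>j=i..n. g_factor (min (R j) (n + 1 - j))) =
      g * (\<Prod>j=Suc i..n. g_factor (min (R j) (n + 1 - j)))"
    using i(1,4) by (subst prod.atLeast_Suc_atMost) (auto simp: g_def)
  moreover have "foldr (\<lambda>i. dir_deriv (basis_vec i)) [i..<Suc n] p =
      foldr (\<lambda>i. dir_deriv (basis_vec i)) [Suc i..<Suc n] r"
    using i(1) by (subst upt_conv_Cons)
      (auto simp: r_def foldr_dir_deriv_commute[OF Suc.prems(2)] simp del: upt_Suc)
  ultimately show ?case
    unfolding i(2,3) by (simp add: mult_ac del: upt_Suc)
qed

section \<open>Hyperbolicity in every positive direction\<close>

text \<open>
  The real roots exhaust the degree, so the factorization over the reals persists for complex
  arguments.
\<close>

lemma hyperbolic_factorization: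
  assumes hyp: "hyperbolic n n q ones" and rf: "real_form n n p"
    and pq: "\<And>x. p (cvec x) = of_real (q x)"
  shows "p (\<lambda>i. cvec x i + s) =
    of_real (q ones) * (\<Prod>a\<in>#proots (line_poly q ones x). of_real a + s)"
proof -
  define r where "r = line_poly q ones x"
  have hom: "homogeneous_poly n n q" and q1: "q ones > 0" and size: "size (proots r) = n"
    using hyp by (auto simp: hyperbolic_def r_def)
  have r: "poly r t = q (\<lambda>i. x i - t)" for t
    using poly_line_poly[OF hom, of ones x t] by (simp add: r_def ones_def)
  obtain f where f: "degree f \<le> n" "coeff f n = p (cvec (\<lambda>_. -1))"
      "\<And>s. poly f s = p (\<lambda>i. cvec x i + s * cvec (\<lambda>_. -1) i)"
    using real_form_line[OF rf, of "cvec (\<lambda>_. -1)" "cvec x"] by blast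
  have f_real: "poly f (of_real t) = of_real (poly r t)" for t
    using pq[of "\<lambda>i. x i - t"] by (simp add: f(3) r cvec_def)
  have "map_poly of_real r = f"
    by (rule poly_eqI_on_reals) (simp add: f_real, simp add: poly_altdef degree_map_poly coeff_map_poly)
  then have "degree r \<le> n" using f(1) by (auto simp: degree_map_poly)
  then have deg: "degree r = n" using size size_proots_le[of r] by simp
  define c where "c = lead_coeff r"
  define g :: "complex poly" where "g = smult (of_real c) (\<Prod>a\<in>#proots r. [:- of_real a, 1:])"
  have r_prod: "poly r t = c * (\<Prod>a\<in>#proots r. t - a)" for t
    by (subst proots_factorization)
      (use size deg in \<open>simp_all add: c_def poly_prod_mset image_mset.compositionality o_def\<close>)
  have g: "poly g s = of_real c * (\<Prod>a\<in>#proots r. s - of_real a)" for s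
    by (simp add: g_def poly_prod_mset image_mset.compositionality o_def)
  have "of_real (\<Prod>a\<in>#M. t - a) = (\<Prod>a\<in>#M. complex_of_real t - of_real a)" for M t
    by (induction M) auto
  then have "f = g"
    by (intro poly_eqI_on_reals) (simp add: f_real r_prod g)
  have neg: "(\<Prod>a\<in>#M. - s - of_real a) = (-1) ^ size M * (\<Prod>a\<in>#M. of_real a + s)" for M and s :: complex
    by (induction M) (auto simp: algebra_simps)
  have *: "p (\<lambda>i. cvec x i + s) = of_real c * (-1) ^ n * (\<Prod>a\<in>#proots r. of_real a + s)" for s
    using f(3)[of "- s"] g[of "- s"] neg[of s "proots r"] \<open>f = g\<close> size by (simp add: cvec_def mult.assoc)
  have "coeff g n = of_real c"
  proof -
    have "coeff (map_poly of_real r) n = complex_of_real c"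
      by (simp add: coeff_map_poly c_def deg)
    then show ?thesis using \<open>map_poly of_real r = f\<close> \<open>f = g\<close> by simp
  qed
  then have "of_real c = p (\<lambda>i. (-1) * cvec ones i)"
    using f(2) \<open>f = g\<close> by (simp add: cvec_def ones_def)
  also have "\<dots> = (-1) ^ n * of_real (q ones)"
    using real_form_homogeneous[OF rf, of "-1" "cvec ones"] pq[of ones] by simp
  finally show ?thesis
    using *[of s] by (simp add: r_def flip: power_mult_distrib)
qed

lemma line_roots_nonneg:
  assumes "P_hyperbolic n q" "\<forall>i\<in>{1..n}. 0 \<le> x i" "a \<in># proots (line_poly q ones x)"
  shows "0 \<le> a"
proof -
  define xs where "xs = sorted_list_of_multiset (proots (line_poly q ones x))"
  have "size (proots (line_poly q ones x)) = n"
    using assms(1) by (auto simp: P_hyperbolic_def hyperbolic_def)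
  then have len: "length xs = n"
    unfolding xs_def by (metis mset_sorted_list_of_multiset size_mset)
  have mem: "a \<in> set xs" using assms(3) by (simp add: xs_def)
  then have n: "n > 0" using len by (cases xs) auto
  have "e_nonnegative n q ones x" using assms(1,2) by (simp add: P_hyperbolic_def)
  then have "0 \<le> xs ! 0"
    using n len by (simp add: e_nonnegative_def eig_def rev_nth flip: xs_def)
  moreover have "sorted xs" by (simp add: xs_def)
  moreover obtain i where "i < n" "a = xs ! i" using mem len by (metis in_set_conv_nth)
  ultimately show ?thesis
    using len by (metis le0 order_trans sorted_nth_mono)
qed

lemma hyp_rank_eq_size:
  assumes "hyperbolic n n q ones"
  shows "hyp_rank n q ones x = size (filter_mset (\<lambda>a. a \<noteq> 0) (proots (line_poly q ones x)))"
proof -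
  define xs where "xs = rev (sorted_list_of_multiset (proots (line_poly q ones x)))"
  have mset: "mset xs = proots (line_poly q ones x)" by (simp add: xs_def)
  have len: "length xs = n"
  proof -
    have "size (proots (line_poly q ones x)) = n" using assms by (simp add: hyperbolic_def)
    then show ?thesis by (metis mset size_mset)
  qed
  have "{i \<in> {1..n}. xs ! (i - 1) \<noteq> 0} = Suc ` {i. i < n \<and> xs ! i \<noteq> 0}"
    by (force simp: image_iff intro: exI[of _ "_ - 1"])
  then have "hyp_rank n q ones x = card {i. i < n \<and> xs ! i \<noteq> 0}"
    by (simp add: hyp_rank_def eig_def card_image flip: xs_def)
  also have "\<dots> = length (filter (\<lambda>a. a \<noteq> 0) xs)"
    by (simp add: length_filter_conv_card len)
  also have "\<dots> = size (filter_mset (\<lambda>a. a \<noteq> 0) (mset xs))"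
    by (metis mset_filter size_mset)
  finally show ?thesis by (simp add: mset)
qed

text \<open>
  The vector \<open>b\<close> stays in the nonnegative orthant after subtraction of its smallest coordinate
  \<open>e\<close>, so that all its eigenvalues are at least \<open>e > 0\<close>.
\<close>

lemma positive_shift_roots:
  assumes P: "P_hyperbolic n q" and rf: "real_form n n p"
    and pq: "\<And>x. p (cvec x) = of_real (q x)" and b: "\<forall>i\<in>{1..n}. 0 < b i"
  shows "0 < q b" and "\<not> (s \<in> \<real> \<and> Re s < 0) \<Longrightarrow> p (\<lambda>i. cvec b i + s) \<noteq> 0"
proof -
  have hyp: "hyperbolic n n q ones" using P by (simp add: P_hyperbolic_def)
  then have q1: "q ones > 0" by (simp add: hyperbolic_def)
  define e where "e = Min (insert 1 (b ` {1..n}))"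
  have e: "0 < e" "\<forall>i\<in>{1..n}. e \<le> b i"
    unfolding e_def using b by (auto simp del: Min_insert intro!: Min_le)
  define L where "L = proots (line_poly q ones (\<lambda>i. b i - e))"
  have L: "0 \<le> a" if "a \<in># L" for a
    using line_roots_nonneg[OF P _ that[unfolded L_def]] e(2) by simp
  have eq: "p (\<lambda>i. cvec b i + s) = of_real (q ones) * (\<Prod>a\<in>#L. of_real (a + e) + s)" for s
    using hyperbolic_factorization[OF hyp rf pq, of "\<lambda>i. b i - e" "of_real e + s"]
    by (simp add: L_def cvec_def add.assoc)
  have "complex_of_real (q b) = of_real (q ones * (\<Prod>a\<in>#L. a + e))"
  proof -
    have "(\<Prod>a\<in>#M. complex_of_real (a + e)) = of_real (\<Prod>a\<in>#M. a + e)" for M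
      by (induction M) auto
    then show ?thesis using eq[of 0] pq[of b] by simp
  qed
  then have "q b = q ones * (\<Prod>a\<in>#L. a + e)"
    using of_real_eq_iff by blast
  moreover have "0 < (\<Prod>a\<in>#L. a + e)"
    using L by (induction L) (use e(1) in \<open>auto intro!: mult_pos_pos add_nonneg_pos\<close>)
  ultimately show "0 < q b" using q1 by simp
  assume s: "\<not> (s \<in> \<real> \<and> Re s < 0)"
  have "of_real (a + e) + s \<noteq> 0" if "a \<in># L" for a
  proof
    assume "of_real (a + e) + s = 0"
    then have "s = of_real (- (a + e))" by (simp add: complex_eq_iff)
    then have "s \<in> \<real>" "Re s < 0" using L[OF that] e(1) by auto
    with s show False by simp
  qed
  then show "p (\<lambda>i. cvec b i + s) \<noteq> 0"
    using q1 by (auto simp: eq prod_mset_zero_iff)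
qed

text \<open>
  Garding's argument. The roots \<open>t\<close> of \<open>F s t = p (s x + \<i> (1, \<dots>, 1) + t b)\<close> are followed for
  \<open>s \<in> [0, 1]\<close>. They are never real, by hyperbolicity in the direction of the ones, and at \<open>s = 0\<close> they
  all lie in the lower half-plane. A first parameter \<open>s0\<close> with a root in the closed upper
  half-plane is impossible: for \<open>s < s0\<close> the modulus of \<open>F s t\<close> is at least
  \<open>\<bar>p b\<bar> * Im t ^ d\<close>, this remains true at \<open>s0\<close>, and so a root there would be real.
\<close>

lemma garding_lower_half_plane:
  assumes rf: "real_form n d p"
    and ones: "\<And>x. p (\<lambda>i. Complex (x i) 1) \<noteq> 0"
    and b: "p (cvec b) \<noteq> 0"
    and ray: "\<And>s. \<not> (s \<in> \<real> \<and> Re s < 0) \<Longrightarrow> p (\<lambda>i. cvec b i + s) \<noteq> 0"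
    and t: "0 \<le> Im t"
  shows "cmod (p (cvec b)) * Im t ^ d \<le> cmod (p (\<lambda>i. cvec x i + \<i> + t * cvec b i))"
proof -
  define F where "F s t = p (\<lambda>i. of_real s * cvec x i + \<i> + t * cvec b i)" for s :: real and t
  define good where "good s \<longleftrightarrow> (\<forall>t. 0 \<le> Im t \<longrightarrow> F s t \<noteq> 0)" for s
  have bound: "cmod (p (cvec b)) * Im t ^ d \<le> cmod (F s t)" if "good s" "0 \<le> Im t" for s t
  proof -
    obtain f where f: "degree f \<le> d" "coeff f d = p (cvec b)" "\<And>t. poly f t = F s t"
      using real_form_line[OF rf, of "cvec b" "\<lambda>i. of_real s * cvec x i + \<i>"]
      unfolding F_def by blast
    have "Im r \<le> 0" if "poly f r = 0" for r
      using \<open>good s\<close> that f(3)[of r] by (metis good_def linear)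
    from norm_poly_ge_Im_power[OF f(1) this \<open>0 \<le> Im t\<close>] show ?thesis
      by (simp add: f)
  qed
  have real_t: "F s t \<noteq> 0" if "Im t = 0" for s t
  proof -
    have "(\<lambda>i. of_real s * cvec x i + \<i> + t * cvec b i) = (\<lambda>i. Complex (s * x i + Re t * b i) 1)"
      using that by (auto simp: cvec_def complex_eq_iff)
    then show ?thesis using ones by (simp add: F_def)
  qed
  have good_0: "good 0"
    unfolding good_def
  proof (intro allI impI)
    fix t assume t: "0 \<le> Im t"
    show "F 0 t \<noteq> 0"
    proof (cases "t = 0")
      case False
      have "(\<lambda>i. of_real 0 * cvec x i + \<i> + t * cvec b i) = (\<lambda>i. t * (cvec b i + \<i> / t))"
        using False by (auto simp: field_simps)
      then have "F 0 t = t ^ d * p (\<lambda>i. cvec b i + \<i> / t)"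
        unfolding F_def using real_form_homogeneous[OF rf, of t "\<lambda>i. cvec b i + \<i> / t"] by metis
      moreover have "\<not> (\<i> / t \<in> \<real> \<and> Re (\<i> / t) < 0)"
      proof
        assume "\<i> / t \<in> \<real> \<and> Re (\<i> / t) < 0"
        moreover have "Re (\<i> / t) = Im t / ((Re t)\<^sup>2 + (Im t)\<^sup>2)" by (simp add: Re_divide)
        moreover have "0 \<le> Im t / ((Re t)\<^sup>2 + (Im t)\<^sup>2)" using t by simp
        ultimately show False by linarith
      qed
      ultimately show ?thesis using ray False by simp
    qed (use real_t in auto)
  qed
  \<comment> \<open>A root \<open>t\<close> may be large, so it is recorded projectively: the triple \<open>(s, a, \<tau>)\<close> stands for
    \<open>t = \<tau> / a\<close>, normalised by \<open>a + \<bar>\<tau>\<bar> = 1\<close>. A root at infinity, \<open>a = 0\<close>, is excluded by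
    \<open>p b \<noteq> 0\<close>.\<close>
  define H where "H u = p (\<lambda>i. of_real (fst u * fst (snd u)) * cvec x i + \<i> * of_real (fst (snd u))
      + snd (snd u) * cvec b i)" for u :: "real \<times> real \<times> complex"
  have contH: "continuous_on UNIV H"
    unfolding H_def by (rule real_form_continuous[OF rf]) (intro continuous_intros)
  define K where "K = ({0..1} \<times> {0..1} \<times> cball 0 1) \<inter>
      ({u. fst (snd u) + cmod (snd (snd u)) = 1} \<inter> {u. 0 \<le> Im (snd (snd u))} \<inter> {u. H u = 0})"
  have "compact K"
    unfolding K_def
    by (intro compact_Int_closed compact_Times closed_Int closed_Collect_eq closed_Collect_le
        continuous_intros contH) auto
  then have compact: "compact (fst ` K)"
    by (intro compact_continuous_image continuous_intros)
  have scale: "H (s, a, of_real a * t) = of_real a ^ d * F s t" for s a t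
    unfolding H_def F_def by (subst real_form_homogeneous[OF rf, symmetric]) (simp add: algebra_simps)
  have in_B: "s \<in> fst ` K" if s: "s \<in> {0..1}" and "\<not> good s" for s
  proof -
    obtain t where t: "0 \<le> Im t" "F s t = 0" using \<open>\<not> good s\<close> by (auto simp: good_def)
    define a where "a = 1 / (1 + cmod t)"
    have a: "0 < a" "a \<le> 1" "a + a * cmod t = 1"
      using add_pos_nonneg[of 1 "cmod t"] by (auto simp: a_def simp flip: add_divide_distrib)
    have "(s, a, of_real a * t) \<in> K"
      using s a t scale[of s a t] unfolding K_def by (auto simp: norm_mult)
    then show ?thesis by force
  qed
  have from_B: "s \<in> {0..1} \<and> \<not> good s" if "s \<in> fst ` K" for s
  proof -
    obtain a t where K: "(s, a, t) \<in> K" using \<open>s \<in> fst ` K\<close> by auto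
    have "a \<noteq> 0"
    proof
      assume "a = 0"
      then have "p (\<lambda>i. t * cvec b i) = 0" "cmod t = 1" using K by (auto simp: K_def H_def)
      then show False using b real_form_homogeneous[OF rf, of t "cvec b"] by auto
    qed
    then have a: "0 < a" using K by (auto simp: K_def)
    have "F s (t / of_real a) = 0"
      using K scale[of s a "t / of_real a"] a by (auto simp: K_def)
    moreover have "0 \<le> Im (t / of_real a)" using K a by (auto simp: K_def)
    ultimately have "\<not> good s" unfolding good_def by blast
    then show ?thesis using K by (auto simp: K_def)
  qed
  have "fst ` K = {}"
  proof (rule ccontr)
    assume "fst ` K \<noteq> {}"
    then obtain s0 where s0: "s0 \<in> fst ` K" "\<And>s. s \<in> fst ` K \<Longrightarrow> s0 \<le> s"
      using compact_attains_inf[OF compact] by blast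
    then obtain t where t: "0 \<le> Im t" "F s0 t = 0"
      using from_B by (force simp: good_def)
    have "s0 \<noteq> 0" using from_B[OF s0(1)] good_0 by auto
    then have s0': "0 < s0" "s0 \<le> 1" using from_B[OF s0(1)] by auto
    have good: "good s" if "0 < s" "s < s0" for s
      using in_B[of s] s0(2)[of s] s0' that by fastforce
    have "continuous_on UNIV (\<lambda>s. F s t)"
      unfolding F_def by (rule real_form_continuous[OF rf]) (intro continuous_intros)
    then have "((\<lambda>s. F s t) \<longlongrightarrow> F s0 t) (at_left s0)"
      by (simp add: continuous_on_eq_continuous_at isCont_def filterlim_at_split)
    then have "cmod (p (cvec b)) * Im t ^ d \<le> cmod (F s0 t)"
    proof (intro tendsto_lowerbound[OF tendsto_norm])
      show "\<forall>\<^sub>F s in at_left s0. cmod (p (cvec b)) * Im t ^ d \<le> cmod (F s t)"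
        using eventually_at_left_real[OF s0'(1)] by eventually_elim (use bound good t in auto)
    qed auto
    then have "Im t ^ d \<le> 0" using b t by (simp add: mult_le_0_iff)
    then have "Im t = 0" using t(1) by (metis less_eq_real_def not_le zero_less_power)
    then show False using real_t t(2) by blast
  qed
  then have "good 1" using in_B[of 1] by auto
  from bound[OF this t] show ?thesis by (simp add: F_def)
qed

text \<open>
  The vector \<open>x + \<i> a (1, \<dots>, 1) + \<i> b\<close> with \<open>a > 0\<close> is \<open>a\<close> times a vector covered by the previous
  lemma with \<open>t = \<i> / a\<close>. The powers of \<open>a\<close> cancel, and \<open>a\<close> tends to 0.
\<close>

lemma garding:
  assumes rf: "real_form n d p"
    and ones: "\<And>x. p (\<lambda>i. Complex (x i) 1) \<noteq> 0"
    and b: "p (cvec b) \<noteq> 0"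
    and ray: "\<And>s. \<not> (s \<in> \<real> \<and> Re s < 0) \<Longrightarrow> p (\<lambda>i. cvec b i + s) \<noteq> 0"
  shows "cmod (p (cvec b)) \<le> cmod (p (\<lambda>i. Complex (x i) (b i)))"
proof -
  define Z where "Z a i = cvec x i + \<i> * of_real a + \<i> * cvec b i" for a :: real and i
  have "continuous_on UNIV (\<lambda>a. p (Z a))"
    by (rule real_form_continuous[OF rf]) (auto simp: Z_def intro!: continuous_intros)
  then have lim: "((\<lambda>a. p (Z a)) \<longlongrightarrow> p (Z 0)) (at_right 0)"
    by (simp add: continuous_on_eq_continuous_at isCont_def filterlim_at_split)
  have "cmod (p (cvec b)) \<le> cmod (p (Z 0))"
  proof (rule tendsto_lowerbound[OF tendsto_norm[OF lim]])
    have "cmod (p (cvec b)) \<le> cmod (p (Z a))" if a: "0 < a" for a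
    proof -
      have "Z a = (\<lambda>i. of_real a * (cvec (\<lambda>i. x i / a) i + \<i> + (\<i> / of_real a) * cvec b i))"
        using a by (auto simp: Z_def cvec_def field_simps)
      then have eq: "p (Z a) = of_real a ^ d *
          p (\<lambda>i. cvec (\<lambda>i. x i / a) i + \<i> + (\<i> / of_real a) * cvec b i)"
        using real_form_homogeneous[OF rf, of "of_real a"] by simp
      have "cmod (p (cvec b)) * Im (\<i> / of_real a) ^ d
          \<le> cmod (p (\<lambda>i. cvec (\<lambda>i. x i / a) i + \<i> + (\<i> / of_real a) * cvec b i))"
        by (rule garding_lower_half_plane[OF rf ones b ray]) (use a in auto)
      then have "a ^ d * (cmod (p (cvec b)) * (1 / a) ^ d) \<le> cmod (p (Z a))"
        unfolding eq norm_mult using a by (simp add: norm_power)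
      then show ?thesis using a by (simp add: power_divide)
    qed
    then show "\<forall>\<^sub>F a in at_right 0. cmod (p (cvec b)) \<le> cmod (p (Z a))"
      using eventually_at_right_less[of 0] by (auto elim: eventually_mono)
  qed simp
  moreover have "Z 0 = (\<lambda>i. Complex (x i) (b i))"
    by (auto simp: Z_def cvec_def complex_eq_iff)
  ultimately show ?thesis by simp
qed

lemma P_hyperbolic_imp_stable_form:
  assumes P: "P_hyperbolic n q" and rf: "real_form n n p"
    and pq: "\<And>x. p (cvec x) = of_real (q x)"
  shows "stable_form n n p"
  unfolding stable_form_def
proof (intro conjI allI impI)
  have hyp: "hyperbolic n n q ones" using P by (simp add: P_hyperbolic_def)
  then have q1: "q ones > 0" by (simp add: hyperbolic_def)
  fix x y :: "nat \<Rightarrow> real" assume y: "\<forall>i\<in>{1..n}. 0 < y i"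
  note pos = positive_shift_roots[OF P rf pq y]
  show "0 < Re (p (cvec y))" using pos(1) pq by simp
  have "p (\<lambda>i. Complex (z i) 1) \<noteq> 0" for z
  proof -
    have "of_real a + \<i> \<noteq> 0" for a by (simp add: complex_eq_iff)
    moreover have "(\<lambda>i. Complex (z i) 1) = (\<lambda>i. cvec z i + \<i>)"
      by (auto simp: cvec_def complex_eq_iff)
    ultimately show ?thesis
      using hyperbolic_factorization[OF hyp rf pq, of z \<i>] q1 by (auto simp: prod_mset_zero_iff)
  qed
  then have "cmod (p (cvec y)) \<le> cmod (p (\<lambda>i. Complex (x i) (y i)))"
    using pos by (intro garding[OF rf]) (auto simp: pq)
  then show "Re (p (cvec y)) \<le> cmod (p (\<lambda>i. Complex (x i) (y i)))"
    using complex_Re_le_cmod order_trans by blast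
qed (rule rf)

lemma stable_form_funpow_dir_deriv:
  assumes "stable_form n d p" "\<forall>i\<in>{1..n}. 0 \<le> v i"
  shows "(dir_deriv v ^^ k) p = (\<lambda>z. 0) \<or> stable_form n (d - k) ((dir_deriv v ^^ k) p)"
proof (induction k)
  case 0
  show ?case using assms(1) by simp
next
  case (Suc k)
  then consider "(dir_deriv v ^^ k) p = (\<lambda>z. 0)" | "stable_form n (d - k) ((dir_deriv v ^^ k) p)" "d - k = 0"
    | "stable_form n (d - k) ((dir_deriv v ^^ k) p)" "d - k \<noteq> 0" by blast
  then show ?case
  proof cases
    case 2
    then obtain c where "(dir_deriv v ^^ k) p = (\<lambda>z. of_real c)"
      using real_form_0_const unfolding stable_form_def by metis
    then show ?thesis by (simp add: dir_deriv_const)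
  next
    case 3
    then show ?thesis using stable_form_dir_deriv_boundary[OF 3 assms(2)] by simp
  qed (simp add: dir_deriv_zero)
qed

text \<open>
  With \<open>e\<close> the vector of ones, reversing the polynomial \<open>s \<mapsto> p (v + s e)\<close> gives
  \<open>s \<mapsto> p (e + s v)\<close>, which therefore is a constant times the product of the \<open>1 + s * a\<close> over the
  eigenvalues \<open>a\<close> of \<open>v\<close>. Its degree is at most the rank, so the next derivative along \<open>v\<close> vanishes at
  \<open>e\<close>. Being stable or zero, that derivative is zero.
\<close>

lemma funpow_dir_deriv_rank:
  assumes P: "P_hyperbolic n q" and rf: "real_form n n p"
    and pq: "\<And>x. p (cvec x) = of_real (q x)" and v: "\<forall>i\<in>{1..n}. 0 \<le> v i"
  shows "(dir_deriv v ^^ Suc (hyp_rank n q ones v)) p = (\<lambda>z. 0)"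
proof -
  define R where "R = hyp_rank n q ones v"
  have hyp: "hyperbolic n n q ones" using P by (simp add: P_hyperbolic_def)
  define L where "L = proots (line_poly q ones v)"
  have size: "size L = n" using hyp by (simp add: L_def hyperbolic_def)
  define h :: "complex poly" where "h = smult (of_real (q ones)) (\<Prod>a\<in>#L. [:1, of_real a:])"
  have "degree (\<Prod>a\<in>#M. [:1, complex_of_real a:]) \<le> size (filter_mset (\<lambda>a. a \<noteq> 0) M)" for M
  proof (induction M)
    case (add a M)
    then show ?case
      using degree_mult_le[of "[:1, complex_of_real a:]" "\<Prod>a\<in>#M. [:1, complex_of_real a:]"] by auto
  qed simp
  then have deg: "degree h \<le> R"
    unfolding h_def R_def hyp_rank_eq_size[OF hyp] L_def[symmetric]
    by (intro order_trans[OF degree_smult_le])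
  have h: "poly h s = p (\<lambda>i. cvec ones i + s * of_real (v i))" for s
  proof (cases "s = 0")
    case True
    have "(\<Prod>a\<in>#M. 1) = (1::complex)" for M :: "real multiset" by simp
    then show ?thesis
      using pq[of ones] True by (simp add: h_def poly_prod_mset image_mset.compositionality o_def)
  next
    case False
    have "(\<Prod>a\<in>#M. 1 + s * of_real a) = s ^ size M * (\<Prod>a\<in>#M. of_real a + 1 / s)" for M
      using False by (induction M) (auto simp: field_simps)
    then have "poly h s = s ^ n * (of_real (q ones) * (\<Prod>a\<in>#L. of_real a + 1 / s))"
      by (simp add: h_def poly_prod_mset image_mset.compositionality o_def size)
    also have "\<dots> = s ^ n * p (\<lambda>i. cvec v i + 1 / s)"
      by (simp add: hyperbolic_factorization[OF hyp rf pq] L_def)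
    also have "\<dots> = p (\<lambda>i. s * (cvec v i + 1 / s))"
      by (rule real_form_homogeneous[OF rf, symmetric])
    also have "(\<lambda>i. s * (cvec v i + 1 / s)) = (\<lambda>i. cvec ones i + s * of_real (v i))"
      using False by (auto simp: cvec_def ones_def field_simps)
    finally show ?thesis .
  qed
  have "degree ((pderiv ^^ R) h) = 0" using deg by (simp add: degree_higher_pderiv)
  then have "(pderiv ^^ Suc R) h = 0" by (simp add: pderiv_eq_0_iff)
  then have "(dir_deriv v ^^ Suc R) p (cvec ones) = 0"
    using higher_pderiv_line[OF rf h, of "Suc R" 0] by (simp del: funpow.simps)
  moreover have "0 < Re (f (cvec ones))" if "stable_form n e f" for e f
    by (rule stable_form_pos[OF that]) (simp add: ones_def)
  ultimately show ?thesis
    using stable_form_funpow_dir_deriv[OF P_hyperbolic_imp_stable_form[OF P rf pq] v, of "Suc R"]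
    unfolding R_def by fastforce
qed

section \<open>Constants and capacity\<close>

text \<open>
  For \<open>j = m - 1 \<ge> 1\<close> and \<open>y = j + 1\<close> the step from \<open>m\<close> to \<open>m + 1\<close> is Bernoulli's inequality
  \<open>(1 - 1 / y\<^sup>2) ^ y \<ge> 1 - 1 / y\<close>, that is, the growth of \<open>(1 + 1 / j) ^ j\<close>.
\<close>

lemma g_factor_antimono:
  assumes "a \<le> b"
  shows "g_factor b \<le> g_factor a"
proof -
  have step: "g_factor (Suc m) \<le> g_factor m" for m
  proof (cases "m \<le> 1")
    case True
    then show ?thesis by (cases m) (auto simp: g_factor_def)
  next
    case False
    then obtain j where j: "m = Suc j" "1 \<le> j" by (cases m) auto
    define y where "y = 1 + real j"
    have y: "2 \<le> y" "of_nat (Suc j) = y" using j by (auto simp: y_def)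
    have "((y - 1) / y * ((y + 1) / y)) ^ Suc j \<ge> 1 + of_nat (Suc j) * (- (1 / y\<^sup>2))"
    proof -
      have "(y - 1) / y * ((y + 1) / y) = 1 + - (1 / y\<^sup>2)"
        using y(1) by (simp add: field_simps power2_eq_square)
      moreover have "1 + of_nat (Suc j) * (- (1 / y\<^sup>2)) \<le> (1 + - (1 / y\<^sup>2)) ^ Suc j"
      proof (rule Bernoulli_inequality)
        have "1 * 1 \<le> y * y" using y(1) by (intro mult_mono) auto
        then show "- 1 \<le> - (1 / y\<^sup>2)" using y(1) by (simp add: power2_eq_square)
      qed
      ultimately show ?thesis by simp
    qed
    moreover have "1 + of_nat (Suc j) * (- (1 / y\<^sup>2)) = (y - 1) / y"
      unfolding y(2) using y(1) by (simp add: field_simps power2_eq_square)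
    ultimately have *: "(y - 1) / y \<le> ((y - 1) / y) ^ Suc j * ((y + 1) / y) ^ Suc j"
      by (simp only: power_mult_distrib)
    have pos: "0 < (y - 1) / y" "0 < y / (y + 1)" using j by (auto simp: y_def)
    have "1 \<le> ((y - 1) / y) ^ j * ((y + 1) / y) ^ Suc j"
    proof (rule mult_left_le_imp_le[OF _ pos(1)])
      show "(y - 1) / y * 1 \<le> (y - 1) / y * (((y - 1) / y) ^ j * ((y + 1) / y) ^ Suc j)"
        using * by (simp only: power_Suc[of "(y - 1) / y"] mult.assoc mult_1_right)
    qed
    then have "(y / (y + 1)) ^ Suc j * 1 \<le>
        (y / (y + 1)) ^ Suc j * (((y - 1) / y) ^ j * ((y + 1) / y) ^ Suc j)"
      by (rule mult_left_mono) (intro zero_le_power less_imp_le pos(2))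
    also have "\<dots> = ((y - 1) / y) ^ j * (y / (y + 1) * ((y + 1) / y)) ^ Suc j"
      by (simp only: power_mult_distrib mult_ac)
    also have "y / (y + 1) * ((y + 1) / y) = 1" using j by (simp add: y_def)
    finally show ?thesis
      using j by (simp add: g_factor_def y_def add.commute)
  qed
  show ?thesis using lift_Suc_antimono_le[of g_factor] step assms by blast
qed

lemma prod_g_factor: "(\<Prod>i=1..k. g_factor i) = fact k / real k ^ k"
proof (induction k)
  case (Suc k)
  have "(\<Prod>i=1..Suc k. g_factor i) = fact k / real k ^ k * (real k / real (Suc k)) ^ k"
    by (simp add: Suc.IH[symmetric] g_factor_def)
  also have "\<dots> = fact (Suc k) / real (Suc k) ^ Suc k"
    by (cases "k = 0") (simp_all add: power_divide del: of_nat_Suc)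
  finally show ?case .
qed simp

text \<open>
  The first \<open>n - k\<close> factors are at least \<open>g_factor k\<close>, since the rank is at most \<open>k\<close>. The last
  \<open>k\<close> factors are at least \<open>g_factor (n + 1 - i)\<close> and form the telescoping product.
\<close>

lemma prod_g_factor_bounded_rank:
  assumes "1 \<le> k" "k \<le> n" "\<And>i. i \<in> {1..n} \<Longrightarrow> R i \<le> k"
  shows "((real k - 1) / real k) ^ ((k - 1) * (n - k)) * (fact k / real k ^ k)
    \<le> (\<Prod>i=1..n. g_factor (min (R i) (n + 1 - i)))"
proof -
  have "((real k - 1) / real k) ^ ((k - 1) * (n - k)) * (fact k / real k ^ k) =
      (\<Prod>i=1..n - k. g_factor k) * (\<Prod>i=1..k. g_factor i)"
    unfolding prod_g_factor by (simp add: g_factor_def power_mult)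
  also have "(\<Prod>i=1..k. g_factor i) = (\<Prod>i=n - k + 1..n. g_factor (n + 1 - i))"
    by (rule prod.reindex_bij_witness[of _ "\<lambda>i. n + 1 - i" "\<lambda>i. n + 1 - i"]) (use assms in auto)
  also have "(\<Prod>i=1..n - k. g_factor k) * (\<Prod>i=n - k + 1..n. g_factor (n + 1 - i))
      \<le> (\<Prod>i=1..n - k. g_factor (min (R i) (n + 1 - i))) *
        (\<Prod>i=n - k + 1..n. g_factor (min (R i) (n + 1 - i)))"
    by (intro mult_mono prod_mono prod_nonneg conjI g_factor_antimono)
       (use assms in \<open>auto simp: g_factor_nonneg min.coboundedI1\<close>)
  also have "\<dots> = (\<Prod>i\<in>{1..n - k} \<union> {n - k + 1..n}. g_factor (min (R i) (n + 1 - i)))"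
    by (intro prod.union_disjoint[symmetric]) auto
  also have "{1..n - k} \<union> {n - k + 1..n} = {1..n}" using assms by auto
  finally show ?thesis .
qed

lemma homogeneous_poly_imp_real_form:
  assumes "homogeneous_poly n d q"
  obtains p where "real_form n d p" "\<And>x. p (cvec x) = of_real (q x)"
proof -
  obtain c where c: "\<And>x. q x = (\<Sum>a\<in>multi_indices n d. c a * (\<Prod>i=1..n. x i ^ a i))"
    using assms unfolding homogeneous_poly_def by blast
  define p where "p = (\<lambda>z. \<Sum>a\<in>multi_indices n d. complex_of_real (c a) * (\<Prod>i=1..n. z i ^ a i))"
  have "real_form n d p"
    unfolding p_def
  proof (intro real_form_sum finite_multi_indices real_form_scale)
    fix a assume "a \<in> multi_indices n d"
    then have "(\<Sum>i=1..n. a i) = d" by (simp add: multi_indices_def)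
    then show "real_form n d (\<lambda>z. \<Prod>i=1..n. z i ^ a i)"
      using real_form_monomial[of "{1..n}" n a] by simp
  qed
  moreover have "p (cvec x) = of_real (q x)" for x
    by (simp add: p_def c cvec_def)
  ultimately show ?thesis using that by blast
qed

lemma partial_deriv_real_form:
  assumes "real_form n d p"
  shows "partial_deriv i (\<lambda>x. Re (p (cvec x))) = (\<lambda>x. Re (dir_deriv (basis_vec i) p (cvec x)))"
proof
  fix x
  define F where "F s = p (\<lambda>j. cvec (x(i := 0)) j + s * of_real (basis_vec i j))" for s
  have F: "(F has_field_derivative
      dir_deriv (basis_vec i) p (\<lambda>j. cvec (x(i := 0)) j + of_real (x i) * of_real (basis_vec i j)))
      (at (of_real (x i)))"
    unfolding F_def by (rule real_form_has_deriv[OF assms])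
  have upd: "(\<lambda>j. cvec (x(i := 0)) j + of_real t * of_real (basis_vec i j)) = cvec (x(i := t))" for t
    by (auto simp: cvec_def basis_vec_def)
  from F have "(F has_field_derivative dir_deriv (basis_vec i) p (cvec x)) (at (of_real (x i)))"
    unfolding upd by simp
  then have "((\<lambda>t. F (of_real t)) has_vector_derivative dir_deriv (basis_vec i) p (cvec x)) (at (x i))"
    by (rule has_vector_derivative_real_field)
  then have "((\<lambda>t. Re (F (of_real t))) has_field_derivative
      Re (dir_deriv (basis_vec i) p (cvec x))) (at (x i))"
    by (rule has_field_derivative_Re)
  then show "partial_deriv i (\<lambda>x. Re (p (cvec x))) x = Re (dir_deriv (basis_vec i) p (cvec x))"
    unfolding partial_deriv_def F_def upd by (rule DERIV_imp_deriv)
qed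

lemma mixed_deriv_real_form:
  assumes "real_form n d p"
  shows "mixed_deriv n (\<lambda>x. Re (p (cvec x))) =
    (\<lambda>x. Re (foldr (\<lambda>i. dir_deriv (basis_vec i)) [1..<Suc n] p (cvec x)))"
proof -
  have "\<exists>e. real_form n e (foldr (\<lambda>i. dir_deriv (basis_vec i)) xs p) \<and>
      foldr partial_deriv xs (\<lambda>x. Re (p (cvec x))) =
      (\<lambda>x. Re (foldr (\<lambda>i. dir_deriv (basis_vec i)) xs p (cvec x)))" for xs
  proof (induction xs)
    case Nil
    show ?case using assms by auto
  next
    case (Cons i xs)
    then obtain e where e: "real_form n e (foldr (\<lambda>i. dir_deriv (basis_vec i)) xs p)"
      "foldr partial_deriv xs (\<lambda>x. Re (p (cvec x))) =
        (\<lambda>x. Re (foldr (\<lambda>i. dir_deriv (basis_vec i)) xs p (cvec x)))"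
      by blast
    show ?case
      using real_form_dir_deriv[OF e(1)] by (auto simp: e(2) partial_deriv_real_form[OF e(1)])
  qed
  then show ?thesis unfolding mixed_deriv_def by blast
qed

lemma P_hyperbolic_values_nonneg:
  assumes P: "P_hyperbolic n q" and y: "\<forall>i\<in>{1..n}. 0 < y i"
  shows "0 \<le> q y"
proof -
  have "homogeneous_poly n n q" using P by (simp add: P_hyperbolic_def hyperbolic_def)
  then obtain p where "real_form n n p" "\<And>x. p (cvec x) = of_real (q x)"
    by (rule homogeneous_poly_imp_real_form) blast
  then show ?thesis using positive_shift_roots(1)[OF P _ _ y] by (simp add: less_imp_le)
qed

lemma Cap_nonneg:
  assumes P: "P_hyperbolic n q"
  shows "0 \<le> Cap n q"
  unfolding Cap_def
proof (rule cInf_greatest)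
  have "q ones \<in> {q x |x. (\<forall>i\<in>{1..n}. 0 < x i) \<and> (\<Prod>i=1..n. x i) = 1}"
    by (auto intro!: exI[of _ ones] simp: ones_def)
  then show "{q x |x. (\<forall>i\<in>{1..n}. 0 < x i) \<and> (\<Prod>i=1..n. x i) = 1} \<noteq> {}" by blast
qed (use P_hyperbolic_values_nonneg[OF P] in auto)

text \<open>
  The capacity is an infimum over vectors with product 1; homogeneity in degree \<open>n\<close> transfers the
  bound to all positive vectors after division by the \<open>n\<close>-th root of the product.
\<close>

lemma Cap_bound:
  assumes P: "P_hyperbolic n q" and rf: "real_form n n p"
    and pq: "\<And>x. p (cvec x) = of_real (q x)" and y: "\<forall>i\<in>{1..n}. 0 < y i"
  shows "Cap n q * (\<Prod>i=1..n. y i) \<le> q y"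
proof (cases "n = 0")
  case True
  have "q x = q y" for x
    using real_form_cong[OF rf, of "cvec x" "cvec y"] pq True by simp
  then have "{q x |x. (\<forall>i\<in>{1..n}. 0 < x i) \<and> (\<Prod>i=1..n. x i) = 1} = {q y}"
    using True by auto
  then show ?thesis using True by (simp add: Cap_def)
next
  case False
  define c where "c = root n (\<Prod>i=1..n. y i)"
  have prod: "0 < (\<Prod>i=1..n. y i)" using y by (intro prod_pos) auto
  then have c: "0 < c" "c ^ n = (\<Prod>i=1..n. y i)" using False by (auto simp: c_def)
  have "Cap n q \<le> q (\<lambda>i. y i / c)"
    unfolding Cap_def
  proof (rule cInf_lower)
    have "(\<Prod>i=1..n. y i / c) = 1"
      using c prod by (simp add: prod_dividef del: prod_zero_iff)
    then show "q (\<lambda>i. y i / c) \<in> {q x |x. (\<forall>i\<in>{1..n}. 0 < x i) \<and> (\<Prod>i=1..n. x i) = 1}"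
      using y c(1) by (auto intro!: exI[of _ "\<lambda>i. y i / c"])
    show "bdd_below {q x |x. (\<forall>i\<in>{1..n}. 0 < x i) \<and> (\<Prod>i=1..n. x i) = 1}"
      using P_hyperbolic_values_nonneg[OF P] by (auto intro!: bdd_belowI[of _ 0])
  qed
  then have "Cap n q * c ^ n \<le> c ^ n * q (\<lambda>i. y i / c)"
    using c(1) by (simp add: mult.commute)
  also have "complex_of_real (c ^ n * q (\<lambda>i. y i / c)) = of_real (q y)"
    using real_form_homogeneous[OF rf, of "of_real c" "cvec (\<lambda>i. y i / c)"] pq[of "\<lambda>i. y i / c"] pq[of y] c(1)
    by (simp add: cvec_def)
  then have "c ^ n * q (\<lambda>i. y i / c) = q y" using of_real_eq_iff by blast
  finally show ?thesis by (simp add: c(2))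
qed

section \<open>The lower bound for the mixed derivative\<close>

theorem theorem2p14:
  fixes n :: nat and q :: "(nat \<Rightarrow> real) \<Rightarrow> real"
  assumes "P_hyperbolic n q"
  shows "mixed_deriv n q (\<lambda>_. 0) \<ge> (\<Prod>i=1..n. g_factor (G n q i)) * Cap n q \<and>
    (\<forall>k::nat. 1 \<le> k \<and> k \<le> n \<and> (\<forall>i\<in>{1..n}. hyp_rank n q ones (basis_vec i) \<le> k) \<longrightarrow>
      mixed_deriv n q (\<lambda>_. 0) \<ge>
        ((real k - 1) / real k) ^ ((k - 1) * (n - k)) * (fact k / real k ^ k) * Cap n q)"
proof -
  define R where "R i = hyp_rank n q ones (basis_vec i)" for i
  have "homogeneous_poly n n q"
    using assms by (simp add: P_hyperbolic_def hyperbolic_def)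
  then obtain p where rf: "real_form n n p" and pq: "\<And>x. p (cvec x) = of_real (q x)"
    by (rule homogeneous_poly_imp_real_form) blast
  have "(\<Prod>i=n - n + 1..n. g_factor (min (R i) (n + 1 - i))) * Cap n q
      \<le> Re (foldr (\<lambda>i. dir_deriv (basis_vec i)) [n - n + 1..<Suc n] p (\<lambda>_. 0))"
  proof (rule capacity_elimination[OF order_refl rf _ Cap_nonneg[OF assms]])
    show "p = (\<lambda>z. 0) \<or> stable_form n n p"
      using P_hyperbolic_imp_stable_form[OF assms rf pq] by blast
    show "Cap n q * (\<Prod>j\<in>{n - n + 1..n}. y j) \<le> Re (p (cvec y))" if "\<forall>j\<in>{1..n}. 0 < y j" for y
      using Cap_bound[OF assms rf pq that] by (simp add: pq)
    show "(dir_deriv (basis_vec i) ^^ Suc (R i)) p = (\<lambda>z. 0)" for i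
      unfolding R_def by (rule funpow_dir_deriv_rank[OF assms rf pq]) (simp add: basis_vec_def)
  qed
  moreover have "mixed_deriv n q (\<lambda>_. 0) =
      Re (foldr (\<lambda>i. dir_deriv (basis_vec i)) [1..<Suc n] p (\<lambda>_. 0))"
  proof -
    have "q = (\<lambda>x. Re (p (cvec x)))" by (simp add: pq)
    then have "mixed_deriv n q (\<lambda>_. 0) =
        Re (foldr (\<lambda>i. dir_deriv (basis_vec i)) [1..<Suc n] p (cvec (\<lambda>_. 0)))"
      using mixed_deriv_real_form[OF rf] by metis
    moreover have "cvec (\<lambda>_. 0) = (\<lambda>_. 0)" by (simp add: cvec_def)
    ultimately show ?thesis by simp
  qed
  ultimately have main: "(\<Prod>i=1..n. g_factor (min (R i) (n + 1 - i))) * Cap n q \<le> mixed_deriv n q (\<lambda>_. 0)"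
    by simp
  have "((real k - 1) / real k) ^ ((k - 1) * (n - k)) * (fact k / real k ^ k) * Cap n q
      \<le> mixed_deriv n q (\<lambda>_. 0)"
    if "1 \<le> k" "k \<le> n" "\<forall>i\<in>{1..n}. R i \<le> k" for k
    using prod_g_factor_bounded_rank[of k n R] that main
      mult_right_mono[OF _ Cap_nonneg[OF assms]] order_trans by blast
  with main show ?thesis
    unfolding G_def R_def by blast
qed

end
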